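(* Let $G$ be a group of order $144$ in which all groups of order $12$ can be embedded. Then $G\cong S_3\times S_4$.
   Context: A group $K$ can be embedded in a group $G$ if $G$ has a subgroup isomorphic to $K$; "all groups of order $12$ can be embedded in $G$" means that every group of order $12$ is isomorphic to some subgroup of $G$. $S_n$ is the symmetric group of degree $n$. *)

theory Defs
  imports "HOL-Algebra.Algebra"
begin

definition embeds_in :: "('a, 'c) monoid_scheme \<Rightarrow> ('b, 'd) monoid_scheme \<Rightarrow> bool"
  where "embeds_in K G \<longleftrightarrow> (\<exists>H. subgroup H G \<and> K \<cong> G\<lparr>carrier := H\<rparr>)"

text \<open>
  A quantifier inside a formula cannot range over groups of all carrier types. Groups carried
  by sets of natural numbers represent every finite group up to isomorphism, so for
  \<open>n > 0\<close> nothing is lost; lemma \<open>all_groups_of_order_embed_inD\<close> below makes this precise.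
\<close>

definition all_groups_of_order_embed_in :: "nat \<Rightarrow> ('a, 'b) monoid_scheme \<Rightarrow> bool"
  where "all_groups_of_order_embed_in n G \<longleftrightarrow>
    (\<forall>K :: nat monoid. group K \<and> order K = n \<longrightarrow> embeds_in K G)"

lemma finite_group_iso_nat:
  fixes K :: "('a, 'b) monoid_scheme"
  assumes "group K" "finite (carrier K)"
  obtains L :: "nat monoid" where "group L" "K \<cong> L"
proof -
  obtain f :: "'a \<Rightarrow> nat" where f: "inj_on f (carrier K)"
    using finite_imp_inj_to_nat_seg[OF assms(2)] by blast
  let ?g = "inv_into (carrier K) f"
  define L :: "nat monoid" where
    "L = \<lparr>carrier = f ` carrier K, monoid.mult = (\<lambda>x y. f (?g x \<otimes>\<^bsub>K\<^esub> ?g y)), one = f \<one>\<^bsub>K\<^esub>\<rparr>"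
  interpret K: group K by fact
  have iso: "f \<in> iso K L"
    using f by (auto simp: iso_def hom_def L_def bij_betw_def)
  have "group (L\<lparr>one := f \<one>\<^bsub>K\<^esub>\<rparr>)"
    by (rule K.iso_imp_img_group[OF iso])
  then have "group L" by (simp add: L_def)
  moreover have "K \<cong> L" using iso by (rule is_isoI)
  ultimately show thesis by (rule that)
qed

lemma all_groups_of_order_embed_inD:
  fixes K :: "('k, 'l) monoid_scheme"
  assumes "all_groups_of_order_embed_in n G" "0 < n" "group K" "order K = n"
  shows "embeds_in K G"
proof -
  have "finite (carrier K)"
    using assms(2,4) by (metis card.infinite less_irrefl order_def)
  then obtain L :: "nat monoid" where L: "group L" "K \<cong> L"
    using finite_group_iso_nat assms(3) by blast
  moreover have "order L = n"
    using iso_same_card[OF L(2)] assms(4) by (simp add: order_def)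
  ultimately obtain H where "subgroup H G" "L \<cong> G\<lparr>carrier := H\<rparr>"
    using assms(1) unfolding all_groups_of_order_embed_in_def embeds_in_def by blast
  then show ?thesis
    using L(2) iso_trans unfolding embeds_in_def by blast
qed

end

theory Submission
  imports Defs "HOL-Number_Theory.Cong"
begin

text \<open>
  Let \<open>A\<close> be a copy of the alternating group of degree 4 in \<open>G\<close>, with Klein subgroup \<open>V\<close> and an
  element \<open>y\<close> of order 3, let \<open>P\<close> be a Sylow 3-subgroup containing \<open>y\<close>, and let \<open>N\<close> be its
  normalizer. The commutator of \<open>y\<close> with a nontrivial element of \<open>V\<close> is an involution, so it is
  not in \<open>P\<close>; hence \<open>V\<close> meets \<open>N\<close> trivially and \<open>N\<close> has order at most 36. Sylow's congruence between
  the indices of \<open>P\<close> in \<open>G\<close> and in \<open>N\<close> leaves 9 and 36. The dihedral group of order 12 contains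
  an element that inverts an element of order 3, and Burnside's fusion lemma replaces it by an
  element of \<open>N\<close>, which cannot lie in the abelian group \<open>P\<close>. So \<open>N\<close> has order 36 and \<open>G = VN\<close>
  (lemmas \<open>card_N\<close> and \<open>VN_decomp\<close>): there are four Sylow 3-subgroups and \<open>V\<close> permutes them regularly.

  The core \<open>D\<close> of \<open>P\<close> has order 3, and an element of \<open>P\<close> outside \<open>D\<close> lies in no other Sylow
  3-subgroup. Therefore whatever conjugates such an element into \<open>P\<close> lies in \<open>N\<close>
  (\<open>fusion_outside_D\<close>). Elements of \<open>N\<close> act by a sign on \<open>D\<close> and by a sign on \<open>P/D\<close>; the elements
  on which both signs are trivial form \<open>B\<close>, the centralizer of \<open>P\<close>.

  If \<open>B = P\<close>, the two signs identify \<open>N/P\<close> with a Klein group, and the kernel \<open>K\<close> of the action on the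
  four Sylow 3-subgroups is a symmetric group of degree 3 with \<open>D\<close> as its subgroup of order 3. Then
  \<open>G\<close> acts on the four cosets of \<open>N\<close> and, by conjugation, on the three involutions of \<open>K\<close>. Only the
  identity is trivial on both sets, and the order of \<open>G\<close> is the product of 4! and 3!, so \<open>G\<close> is the
  full product (\<open>iso_if_self_centralizing\<close>).

  Otherwise \<open>B\<close> contains a single involution \<open>z\<close>, it is central in \<open>G\<close>, and all elements of \<open>N\<close>
  outside \<open>B\<close> whose order divides 4 have the same square (\<open>squares_agree\<close>). This is incompatible
  with the remaining subgroups of order 12. If \<open>D\<close> is central, the elements of order 3 that are
  inverted in the dihedral and in the dicyclic group are conjugate into \<open>P\<close> but lie outside \<open>D\<close>, so
  the inverting elements lie in \<open>N\<close> outside \<open>B\<close>; one of them is an involution and the other one has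
  order 4 (\<open>central_D_contradiction\<close>). If \<open>D\<close> is not central, its centralizer has no element of
  order 4. Then the cyclic group of order 12 yields an element \<open>u\<close> of order 4 in \<open>K\<close> that inverts
  \<open>D\<close>, has square \<open>z\<close> and commutes with \<open>V\<close>; an involution that inverts an element of order 3 has
  the form \<open>uh\<close> with \<open>h\<close> centralizing \<open>D\<close>, and computing its square puts \<open>z\<close> into \<open>P\<close> or makes \<open>z\<close>
  trivial (\<open>noncentral_D_contradiction\<close>).
\<close>

section \<open>Conjugation\<close>

context group
begin

definition conj_by :: "'a \<Rightarrow> 'a \<Rightarrow> 'a" (infixr \<open>\<rhd>\<close> 75)
  where "g \<rhd> x = g \<otimes> x \<otimes> inv g"

lemma inv_cancel_left [simp]:
  assumes "x \<in> carrier G" "y \<in> carrier G"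
  shows "inv x \<otimes> (x \<otimes> y) = y" "x \<otimes> (inv x \<otimes> y) = y"
  using assms by (simp_all add: m_assoc [symmetric])

lemma conj_closed [simp, intro]: "g \<in> carrier G \<Longrightarrow> x \<in> carrier G \<Longrightarrow> g \<rhd> x \<in> carrier G"
  by (simp add: conj_by_def)

lemma conj_mult:
  "g \<in> carrier G \<Longrightarrow> x \<in> carrier G \<Longrightarrow> y \<in> carrier G \<Longrightarrow> g \<rhd> (x \<otimes> y) = (g \<rhd> x) \<otimes> (g \<rhd> y)"
  by (simp add: conj_by_def m_assoc)

lemma conj_inv: "g \<in> carrier G \<Longrightarrow> x \<in> carrier G \<Longrightarrow> g \<rhd> inv x = inv (g \<rhd> x)"
  by (simp add: conj_by_def m_assoc inv_mult_group)

lemma conj_conj: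
  "g \<in> carrier G \<Longrightarrow> h \<in> carrier G \<Longrightarrow> x \<in> carrier G \<Longrightarrow> (g \<otimes> h) \<rhd> x = g \<rhd> h \<rhd> x"
  by (simp add: conj_by_def m_assoc inv_mult_group)

lemma one_conj [simp]: "x \<in> carrier G \<Longrightarrow> \<one> \<rhd> x = x"
  by (simp add: conj_by_def)

lemma conj_one [simp]: "g \<in> carrier G \<Longrightarrow> g \<rhd> \<one> = \<one>"
  by (simp add: conj_by_def)

lemma conj_inv_cancel [simp]:
  assumes "g \<in> carrier G" "x \<in> carrier G"
  shows "inv g \<rhd> g \<rhd> x = x" "g \<rhd> inv g \<rhd> x = x"
  using assms by (simp_all add: conj_conj [symmetric])

lemma conj_inject [simp]:
  "g \<in> carrier G \<Longrightarrow> x \<in> carrier G \<Longrightarrow> y \<in> carrier G \<Longrightarrow> g \<rhd> x = g \<rhd> y \<longleftrightarrow> x = y"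
  by (simp add: conj_by_def)

lemma conj_eq_one_iff [simp]:
  "g \<in> carrier G \<Longrightarrow> x \<in> carrier G \<Longrightarrow> g \<rhd> x = \<one> \<longleftrightarrow> x = \<one>"
  using conj_inject [of g x \<one>] by simp

lemma conj_eq_iff: "g \<in> carrier G \<Longrightarrow> x \<in> carrier G \<Longrightarrow> y \<in> carrier G \<Longrightarrow> g \<rhd> x = y \<longleftrightarrow> g \<otimes> x = y \<otimes> g"
  by (metis conj_by_def inv_solve_right' m_closed)

lemma conj_fixed_sym:
  "g \<in> carrier G \<Longrightarrow> x \<in> carrier G \<Longrightarrow> g \<rhd> x = x \<longleftrightarrow> x \<rhd> g = g"
  by (auto simp: conj_eq_iff)

lemma conj_conj_distrib:
  "g \<in> carrier G \<Longrightarrow> h \<in> carrier G \<Longrightarrow> x \<in> carrier G \<Longrightarrow> (g \<rhd> h) \<rhd> (g \<rhd> x) = g \<rhd> h \<rhd> x"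
  by (simp add: conj_by_def m_assoc inv_mult_group)

lemma conj_pow:
  "g \<in> carrier G \<Longrightarrow> x \<in> carrier G \<Longrightarrow> g \<rhd> (x [^] (k::nat)) = (g \<rhd> x) [^] k"
  by (induction k) (simp_all add: conj_mult)

lemma conj_inv_fixed: "g \<in> carrier G \<Longrightarrow> x \<in> carrier G \<Longrightarrow> g \<rhd> x = x \<Longrightarrow> inv g \<rhd> x = x"
  by (metis conj_inv_cancel(1))

lemma subgroup_centralizer:
  assumes "y \<in> carrier G"
  shows "subgroup {c \<in> carrier G. c \<rhd> y = y} G"
proof (rule subgroupI)
  show "{c \<in> carrier G. c \<rhd> y = y} \<noteq> {}"
    using assms one_conj by blast
qed (use assms in \<open>auto simp: conj_conj conj_inv_fixed\<close>)

section \<open>Group actions and fusion\<close>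

lemma group_actionI:
  assumes closed: "\<And>g x. g \<in> carrier G \<Longrightarrow> x \<in> E \<Longrightarrow> f g x \<in> E"
    and one: "\<And>x. x \<in> E \<Longrightarrow> f \<one> x = x"
    and mult: "\<And>g h x. g \<in> carrier G \<Longrightarrow> h \<in> carrier G \<Longrightarrow> x \<in> E \<Longrightarrow> f (g \<otimes> h) x = f g (f h x)"
  shows "group_action G E (\<lambda>g. restrict (f g) E)"
proof -
  have bij: "restrict (f g) E \<in> Bij E" if g: "g \<in> carrier G" for g
  proof -
    have "bij_betw (f g) E E"
      using g by (intro bij_betw_byWitness [where f' = "f (inv g)"])
        (auto simp: closed one mult [symmetric])
    then show ?thesis
      by (simp add: Bij_def)
  qed
  have "group_hom G (BijGroup E) (\<lambda>g. restrict (f g) E)"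
    unfolding group_hom_def group_hom_axioms_def
  proof (intro conjI homI)
    fix g h assume "g \<in> carrier G" "h \<in> carrier G"
    then show "restrict (f (g \<otimes> h)) E = restrict (f g) E \<otimes>\<^bsub>BijGroup E\<^esub> restrict (f h) E"
      by (simp add: BijGroup_def bij fun_eq_iff compose_def mult closed)
  qed (use bij group_BijGroup [of E] in \<open>auto simp: BijGroup_def\<close>)
  then show ?thesis
    by (simp add: group_action_def)
qed

end

text \<open>
  Every orbit has \<open>p\<close>-power size, so the orbits other than fixed points do not count modulo \<open>p\<close>.
\<close>

lemma (in group_action) card_fixed_points_cong:
  assumes p: "Factorial_Ring.prime p" and ord: "order G = p ^ k" and fin: "finite E"
  shows "[card E = card {x \<in> E. \<forall>g \<in> carrier G. \<phi> g x = x}] (mod p)"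
proof -
  interpret group G
    using group_hom by (simp add: group_hom_def)
  let ?F = "{x \<in> E. \<forall>g \<in> carrier G. \<phi> g x = x}"
  let ?O = "orbits G E \<phi>"
  have subs: "orb \<subseteq> E" if "orb \<in> ?O" for orb
    using that orbits_coverture by blast
  have finO: "finite ?O"
    using fin orbits_coverture by (metis finite_UnionD)
  have singleton: "(\<lambda>x. {x}) ` ?F = {orb \<in> ?O. card orb = 1}"
  proof (intro equalityI subsetI)
    fix orb assume "orb \<in> (\<lambda>x. {x}) ` ?F"
    then obtain x where x: "x \<in> ?F" "orb = {x}"
      by blast
    then have "orbit G \<phi> x = {x}"
      using orbit_refl [of x] by (auto simp: orbit_def)
    then show "orb \<in> {orb \<in> ?O. card orb = 1}"
      using x one_closed by (auto simp: orbits_def)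
  next
    fix orb assume orb: "orb \<in> {orb \<in> ?O. card orb = 1}"
    then obtain x where x: "x \<in> E" "orb = orbit G \<phi> x"
      by (auto simp: orbits_def)
    then have "orb = {x}"
      using orb orbit_refl [OF x(1)] by (metis (mono_tags, lifting) card_1_singletonE mem_Collect_eq singletonD)
    then have "\<phi> g x = x" if "g \<in> carrier G" for g
      using that x(2) by (auto simp: orbit_def)
    then show "orb \<in> (\<lambda>x. {x}) ` ?F"
      using x \<open>orb = {x}\<close> by blast
  qed
  have "[card orb = (if card orb = 1 then 1 else 0)] (mod p)" if "orb \<in> ?O" for orb
  proof -
    obtain x where x: "x \<in> E" "orb = orbit G \<phi> x"
      using \<open>orb \<in> ?O\<close> by (auto simp: orbits_def)
    have "card orb dvd p ^ k"
      using orbit_stabilizer_theorem [OF x(1)] x(2) ord by (metis dvd_triv_left)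
    then obtain j where "card orb = p ^ j"
      using p divides_primepow_nat by blast
    then show ?thesis
      by (cases j) (auto simp: cong_def)
  qed
  then have "[(\<Sum>orb\<in>?O. card orb) = (\<Sum>orb\<in>?O. if card orb = 1 then 1 else 0)] (mod p)"
    by (rule cong_sum)
  moreover have "(\<Sum>orb\<in>?O. card orb) = card E"
    using disjoint_sum [OF fin, of "\<lambda>_. 1::nat"] by simp
  moreover have "(\<Sum>orb\<in>?O. if card orb = 1 then 1 else 0) = card ((\<lambda>x. {x}) ` ?F)"
    unfolding singleton by (simp add: finO card_as_sums)
  moreover have "card ((\<lambda>x. {x}) ` ?F) = card ?F"
    by (simp add: card_image)
  ultimately show ?thesis
    by simp
qed

context group
begin

lemma lcoset_action:
  assumes "subgroup H G"
  shows "group_action G (lcosets H) (\<lambda>g. \<lambda>C\<in>lcosets H. g <# C)"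
proof (rule group_actionI)
  fix g C assume "g \<in> carrier G" "C \<in> lcosets H"
  then show "g <# C \<in> lcosets H"
    using assms by (auto simp: LCOSETS_def lcos_m_assoc subgroup.subset)
next
  fix C assume "C \<in> lcosets H"
  then show "\<one> <# C = C"
    using assms by (metis lcos_mult_one subgroup.lcosets_carrier is_group)
next
  fix g h C assume "g \<in> carrier G" "h \<in> carrier G" "C \<in> lcosets H"
  then show "(g \<otimes> h) <# C = g <# (h <# C)"
    using assms by (metis lcos_m_assoc subgroup.lcosets_carrier is_group)
qed

lemma lcoset_eq_iff_mem:
  assumes "subgroup H G" "x \<in> carrier G" "y \<in> carrier G"
  shows "x <# H = y <# H \<longleftrightarrow> inv x \<otimes> y \<in> H"
proof
  assume "x <# H = y <# H"
  then show "inv x \<otimes> y \<in> H"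
    using assms lcos_self subgroup.lcos_module_imp is_group by metis
next
  assume "inv x \<otimes> y \<in> H"
  then have "y \<in> x <# H"
    using assms subgroup.lcos_module_rev is_group by metis
  then show "x <# H = y <# H"
    using assms l_repr_independence by metis
qed

text \<open>
  The stabilizer of a coset is a conjugate of the subgroup. This translates statements on fixed
  cosets into statements on conjugation.
\<close>

lemma lcoset_translate_eq_iff:
  assumes "subgroup H G" "g \<in> carrier G" "x \<in> carrier G"
  shows "g <# (x <# H) = x <# H \<longleftrightarrow> inv x \<rhd> g \<in> H"
proof -
  have "g <# (x <# H) = x <# H \<longleftrightarrow> x <# H = (g \<otimes> x) <# H"
    using assms by (auto simp: lcos_m_assoc subgroup.subset)
  also have "\<dots> \<longleftrightarrow> inv x \<rhd> g \<in> H"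
    using assms by (simp add: lcoset_eq_iff_mem conj_by_def m_assoc)
  finally show ?thesis .
qed

lemma index_cong_card_fixed_cosets:
  assumes fin: "finite (carrier G)" and H: "subgroup H G" and Q: "subgroup Q G"
    and p: "Factorial_Ring.prime p" and card: "card Q = p ^ k"
  shows "[card (lcosets H) = card {C \<in> lcosets H. \<forall>q\<in>Q. q <# C = C}] (mod p)"
proof -
  interpret group_action "G\<lparr>carrier := Q\<rparr>" "lcosets H" "\<lambda>g. \<lambda>C\<in>lcosets H. g <# C"
    using group_action.induced_action [OF lcoset_action [OF H] Q] .
  have "finite (lcosets H)"
    using fin lcosets_subset_PowG [OF H] by (simp add: finite_subset)
  from card_fixed_points_cong [OF p _ this, of k]
  have "[card (lcosets H) =
    card {C \<in> lcosets H. \<forall>q\<in>Q. (\<lambda>C\<in>lcosets H. q <# C) C = C}] (mod p)"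
    using card by (simp add: order_def)
  moreover have "{C \<in> lcosets H. \<forall>q\<in>Q. (\<lambda>C\<in>lcosets H. q <# C) C = C} =
    {C \<in> lcosets H. \<forall>q\<in>Q. q <# C = C}"
    by auto
  ultimately show ?thesis
    by metis
qed

text \<open>
  Acting on the cosets of \<open>P\<close>, whose number is prime to \<open>p\<close>, the \<open>p\<close>-group \<open>Q\<close> must fix one of them.
  This is the conjugacy part of Sylow's theorem.
\<close>

lemma p_subgroup_conj_into_sylow:
  assumes fin: "finite (carrier G)" and P: "subgroup P G" and Q: "subgroup Q G"
    and p: "Factorial_Ring.prime p" and card: "card Q = p ^ k" and ndvd: "\<not> p dvd card (lcosets P)"
  obtains g where "g \<in> carrier G" "\<And>q. q \<in> Q \<Longrightarrow> g \<rhd> q \<in> P"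
proof -
  have "{C \<in> lcosets P. \<forall>q\<in>Q. q <# C = C} \<noteq> {}"
    using index_cong_card_fixed_cosets [OF fin P Q p card] ndvd
    by (metis card.empty cong_0_iff)
  then obtain x where x: "x \<in> carrier G" "\<And>q. q \<in> Q \<Longrightarrow> q <# (x <# P) = x <# P"
    by (auto simp: LCOSETS_def)
  show thesis
  proof (rule that [of "inv x"])
    show "inv x \<rhd> q \<in> P" if "q \<in> Q" for q
      using x(2) [OF that] that x(1) P Q by (simp add: lcoset_translate_eq_iff subgroup.mem_carrier)
  qed (simp add: x(1))
qed

lemma p_element_conj_into_sylow:
  assumes fin: "finite (carrier G)" and P: "subgroup P G"
    and p: "Factorial_Ring.prime p" and ndvd: "\<not> p dvd card (lcosets P)"
    and x: "x \<in> carrier G" "x [^] (p ^ k) = \<one>"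
  obtains g where "g \<in> carrier G" "g \<rhd> x \<in> P"
proof -
  let ?Q = "generate G {x}"
  have Q: "subgroup ?Q G"
    using x(1) by (intro generate_is_subgroup) simp
  have "ord x dvd p ^ k"
    using x pow_eq_id by blast
  then obtain j where "ord x = p ^ j"
    using p divides_primepow_nat by blast
  then have "card ?Q = p ^ j"
    using generate_pow_card [OF x(1)] by simp
  then obtain g where "g \<in> carrier G" "\<And>q. q \<in> ?Q \<Longrightarrow> g \<rhd> q \<in> P"
    using p_subgroup_conj_into_sylow [OF fin P Q p _ ndvd] by blast
  then show thesis
    using that generate.incl [of x "{x}" G] by blast
qed

lemma mem_normalizer_iff:
  assumes "subgroup P G" "finite (carrier G)"
  shows "g \<in> normalizer G P \<longleftrightarrow> g \<in> carrier G \<and> (\<forall>x\<in>P. g \<rhd> x \<in> P)"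
proof -
  have P: "P \<subseteq> carrier G" "finite P"
    using assms subgroup.subset finite_subset by blast+
  have eq: "g <# P #> inv g = (\<rhd>) g ` P"
    by (auto simp: l_coset_def r_coset_def conj_by_def)
  have "(\<rhd>) g ` P = P \<longleftrightarrow> (\<forall>x\<in>P. g \<rhd> x \<in> P)" if "g \<in> carrier G"
  proof
    assume "\<forall>x\<in>P. g \<rhd> x \<in> P"
    moreover have "inj_on ((\<rhd>) g) P"
      using that P by (auto simp: inj_on_def subset_iff)
    ultimately show "(\<rhd>) g ` P = P"
      using P by (simp add: endo_inj_surj image_subset_iff)
  qed auto
  then show ?thesis
    using P eq unfolding normalizer_def stabilizer_def by auto
qed

text \<open>
  The cosets of \<open>P\<close> that \<open>P\<close> itself fixes are those contained in its normalizer. For a Sylow subgroup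
  the quotient of the two indices is the number of Sylow subgroups, so this carries the information
  of Sylow's congruence.
\<close>

lemma sylow_index_cong_normalizer_index:
  assumes fin: "finite (carrier G)" and P: "subgroup P G"
    and p: "Factorial_Ring.prime p" and card: "card P = p ^ k"
  shows "[order G div card P = card (normalizer G P) div card P] (mod p)"
    and "card P dvd card (normalizer G P)"
proof -
  let ?N = "normalizer G P"
  have N: "subgroup ?N G"
    using normalizer_imp_subgroup [OF subgroup.subset [OF P]] .
  have PN: "P \<subseteq> ?N"
    using fin P by (auto simp: mem_normalizer_iff conj_by_def subgroup.mem_carrier
        subgroup.m_closed subgroup.m_inv_closed)
  have pos: "0 < card P"
    using p card by (simp add: prime_gt_0_nat)
  interpret N: group "G\<lparr>carrier := ?N\<rparr>"
    using N by (rule subgroup_imp_group)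
  have "{C \<in> lcosets P. \<forall>q\<in>P. q <# C = C} = lcosets\<^bsub>G\<lparr>carrier := ?N\<rparr>\<^esub> P"
  proof -
    have "(\<forall>q\<in>P. q <# (x <# P) = x <# P) \<longleftrightarrow> x \<in> ?N" if "x \<in> carrier G" for x
    proof -
      have "(\<forall>q\<in>P. q <# (x <# P) = x <# P) \<longleftrightarrow> inv x \<in> ?N"
        using that P fin
        by (simp add: lcoset_translate_eq_iff mem_normalizer_iff subgroup.mem_carrier)
      then show ?thesis
        using that N by (metis inv_inv subgroup.m_inv_closed)
    qed
    then show ?thesis
      using subgroup.subset [OF N] by (auto simp: LCOSETS_def)
  qed
  then have "[card (lcosets P) = card (lcosets\<^bsub>G\<lparr>carrier := ?N\<rparr>\<^esub> P)] (mod p)"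
    using index_cong_card_fixed_cosets [OF fin P P p card] by simp
  moreover have "card (lcosets P) * card P = order G"
    using l_lagrange [OF fin P] .
  moreover have *: "card (lcosets\<^bsub>G\<lparr>carrier := ?N\<rparr>\<^esub> P) * card P = card ?N"
    using N.l_lagrange [of P] fin subgroup_incl [OF P N PN] subgroup.subset [OF N]
    by (simp add: order_def finite_subset)
  ultimately show "[order G div card P = card (normalizer G P) div card P] (mod p)"
    using pos by (metis div_mult_self_is_m)
  show "card P dvd card (normalizer G P)"
    using * by (metis dvd_triv_right)
qed

lemma card_subgroup_dvd: "subgroup H G \<Longrightarrow> card H dvd order G"
  using lagrange [of H] by (metis dvd_triv_right)

text \<open>
  Both \<open>P\<close> and its conjugate by \<open>g\<close> are Sylow subgroups of the centralizer of the conjugated element,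
  because \<open>P\<close> is abelian. An element of that centralizer moves one onto the other and corrects \<open>g\<close> to an
  element of the normalizer.
\<close>

lemma burnside_fusion:
  assumes fin: "finite (carrier G)" and P: "subgroup P G"
    and p: "Factorial_Ring.prime p" and card: "card P = p ^ k" and ndvd: "\<not> p dvd card (lcosets P)"
    and comm: "\<And>x y. x \<in> P \<Longrightarrow> y \<in> P \<Longrightarrow> x \<otimes> y = y \<otimes> x"
    and g: "g \<in> carrier G" "x \<in> P" "g \<rhd> x \<in> P"
  obtains n where "n \<in> normalizer G P" "n \<rhd> x = g \<rhd> x"
proof -
  define y where "y = g \<rhd> x"
  have xy: "x \<in> carrier G" "y \<in> carrier G" "y \<in> P"
    using g P by (auto simp: y_def subgroup.mem_carrier)
  let ?C = "{c \<in> carrier G. c \<rhd> y = y}"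
  have C: "subgroup ?C G"
    using xy(2) by (rule subgroup_centralizer)
  have PC: "P \<subseteq> ?C"
    using comm xy P by (auto simp: conj_eq_iff subgroup.mem_carrier)
  let ?Q = "(\<rhd>) g ` P"
  have Q: "subgroup ?Q G"
  proof (rule subgroupI)
    show "?Q \<subseteq> carrier G" "?Q \<noteq> {}"
      using g P by (auto simp: subgroup.mem_carrier)
    show "inv a \<in> ?Q" if "a \<in> ?Q" for a
      using that P g by (auto simp: conj_inv [symmetric] subgroup.mem_carrier subgroup.m_inv_closed)
    show "a \<otimes> b \<in> ?Q" if "a \<in> ?Q" "b \<in> ?Q" for a b
      using that P g by (auto simp: conj_mult [symmetric] subgroup.mem_carrier subgroup.m_closed)
  qed
  have QC: "?Q \<subseteq> ?C"
    using comm [of _ x] xy P g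
    by (auto simp: y_def conj_eq_iff conj_mult [symmetric] subgroup.mem_carrier)
  have cardQ: "card ?Q = p ^ k"
    using card P g by (subst card_image) (auto simp: inj_on_def subgroup.mem_carrier)
  interpret C: group "G\<lparr>carrier := ?C\<rparr>"
    using C by (rule subgroup_imp_group)
  have finC: "finite ?C"
    using fin by simp
  have "\<not> p dvd card (lcosets\<^bsub>G\<lparr>carrier := ?C\<rparr>\<^esub> P)"
  proof -
    have "card (lcosets\<^bsub>G\<lparr>carrier := ?C\<rparr>\<^esub> P) * card P = card ?C"
      using C.l_lagrange [of P] finC subgroup_incl [OF P C PC] by (simp add: order_def)
    moreover have "card (lcosets P) * card P = order G"
      using l_lagrange [OF fin P] .
    moreover have "card ?C dvd order G"
      using C by (rule card_subgroup_dvd)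
    ultimately have "card (lcosets\<^bsub>G\<lparr>carrier := ?C\<rparr>\<^esub> P) * card P dvd card (lcosets P) * card P"
      by simp
    then have "card (lcosets\<^bsub>G\<lparr>carrier := ?C\<rparr>\<^esub> P) dvd card (lcosets P)"
      using p card by (simp add: prime_gt_0_nat)
    then show ?thesis
      using ndvd by (blast intro: dvd_trans)
  qed
  then obtain c where *: "c \<in> carrier (G\<lparr>carrier := ?C\<rparr>)"
      "\<And>q. q \<in> ?Q \<Longrightarrow> group.conj_by (G\<lparr>carrier := ?C\<rparr>) c q \<in> P"
    using C.p_subgroup_conj_into_sylow [OF _ subgroup_incl [OF P C PC] subgroup_incl [OF Q C QC] p cardQ] finC
    by auto
  then have c: "c \<in> ?C" "\<And>q. q \<in> ?Q \<Longrightarrow> c \<rhd> q \<in> P"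
  proof -
    have "group.conj_by (G\<lparr>carrier := ?C\<rparr>) c q = c \<rhd> q" for q
      using m_inv_consistent [OF C] \<open>c \<in> carrier (G\<lparr>carrier := ?C\<rparr>)\<close>
      unfolding C.conj_by_def by (simp add: conj_by_def)
    then show "c \<in> ?C" "\<And>q. q \<in> ?Q \<Longrightarrow> c \<rhd> q \<in> P"
      using * by auto
  qed
  show thesis
  proof (rule that [of "c \<otimes> g"])
    show "c \<otimes> g \<in> normalizer G P"
      using c g P fin by (auto simp: mem_normalizer_iff conj_conj subgroup.mem_carrier)
    show "(c \<otimes> g) \<rhd> x = g \<rhd> x"
      using c(1) g xy by (simp add: conj_conj y_def)
  qed
qed

text \<open>
  The centre has at least \<open>p\<close> elements. If \<open>y\<close> were not central, its centralizer would lie strictly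
  between the centre and the whole group, but there is no room for that among the divisors of \<open>p\<^sup>2\<close>.
\<close>

lemma prime_square_subgroup_commute:
  assumes P: "subgroup P G" and p: "Factorial_Ring.prime p" and card: "card P = p ^ 2"
    and xy: "x \<in> P" "y \<in> P"
  shows "x \<otimes> y = y \<otimes> x"
proof -
  let ?Z = "{z \<in> P. \<forall>g\<in>P. g \<rhd> z = z}"
  have mem: "g \<in> carrier G" if "g \<in> P" for g
    using P that by (rule subgroup.mem_carrier)
  have p2: "2 \<le> p"
    using p by (rule prime_ge_2_nat)
  have finP: "finite P"
    using card p2 by (intro card_ge_0_finite) simp
  interpret H: group "G\<lparr>carrier := P\<rparr>"
    using P by (rule subgroup_imp_group)
  have "group_action (G\<lparr>carrier := P\<rparr>) P (\<lambda>g. restrict ((\<rhd>) g) P)"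
  proof (rule H.group_actionI)
    show "g \<rhd> z \<in> P" if "g \<in> carrier (G\<lparr>carrier := P\<rparr>)" "z \<in> P" for g z
      using that P by (simp add: conj_by_def subgroup.m_closed subgroup.m_inv_closed)
  qed (auto simp: conj_conj mem)
  from group_action.card_fixed_points_cong [OF this p, of 2]
  have "[card P = card {z \<in> P. \<forall>g\<in>P. restrict ((\<rhd>) g) P z = z}] (mod p)"
    using card finP by (simp add: order_def)
  moreover have "{z \<in> P. \<forall>g\<in>P. restrict ((\<rhd>) g) P z = z} = ?Z"
    by auto
  ultimately have "p dvd card ?Z"
    using card by (simp add: cong_def mod_eq_0_iff_dvd)
  moreover have "\<one> \<in> ?Z"
    using P mem by (auto simp: subgroup.one_closed)
  then have "?Z \<noteq> {}"
    by (metis empty_iff)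
  then have "0 < card ?Z"
    using finP by (simp only: card_gt_0_iff finite_Collect_conjI) simp
  ultimately have Zp: "p \<le> card ?Z"
    by (rule dvd_imp_le)
  have "x \<rhd> y = y"
  proof (rule ccontr)
    assume neq: "x \<rhd> y \<noteq> y"
    let ?C = "{c \<in> P. c \<rhd> y = y}"
    have "subgroup ?C (G\<lparr>carrier := P\<rparr>)"
    proof -
      have "subgroup (P \<inter> {c \<in> carrier G. c \<rhd> y = y}) G"
        using P subgroup_centralizer mem xy by (intro subgroups_Inter_pair) auto
      moreover have "P \<inter> {c \<in> carrier G. c \<rhd> y = y} = ?C"
        using mem by auto
      ultimately show ?thesis
        using P by (intro subgroup_incl) auto
    qed
    then have "card ?C dvd p ^ 2"
      using H.card_subgroup_dvd [of ?C] card by (simp add: order_def)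
    moreover have "card ?Z < card ?C"
    proof (rule psubset_card_mono)
      show "?Z \<subset> ?C"
      proof
        show "?Z \<subseteq> ?C"
          using conj_fixed_sym xy mem by blast
        have "y \<in> ?C" "y \<notin> ?Z"
          using neq xy mem by (auto simp: conj_eq_iff)
        then show "?Z \<noteq> ?C"
          by blast
      qed
    qed (use finP in simp)
    moreover have "card ?C < card P"
      by (rule psubset_card_mono) (use finP neq xy in auto)
    moreover obtain i where "card ?C = p ^ i" "i \<le> 2"
      using calculation(1) p divides_primepow_nat by blast
    ultimately have "i < 2" "p < p ^ i"
      using Zp card by (auto simp: le_less)
    moreover have "p ^ i \<le> p ^ 1"
      using p2 \<open>i < 2\<close> by (intro power_increasing) auto
    ultimately show False
      by simp
  qed
  then show ?thesis
    using xy mem by (simp add: conj_eq_iff)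
qed

end

text \<open>
  The kernel condition is stated on group elements rather than as injectivity since two actions are
  combined below, neither of which is faithful.
\<close>

lemma (in group_action) hom_to_sym_group:
  assumes "card E = n" "finite E"
  obtains h where "h \<in> hom G (sym_group n)"
    "\<And>g x. g \<in> carrier G \<Longrightarrow> h g = id \<Longrightarrow> x \<in> E \<Longrightarrow> \<phi> g x = x"
proof -
  obtain b where b: "bij_betw b {1..n} E"
    using assms by (metis card_atLeastAtMost diff_Suc_1 finite_atLeastAtMost finite_same_card_bij)
  define b' where "b' = inv_into {1..n} b"
  have b': "bij_betw b' E {1..n}"
    using b by (simp add: b'_def bij_betw_inv_into)
  have [simp]: "b' (b i) = i" if "i \<in> {1..n}" for i
    using b that by (auto simp: b'_def bij_betw_inv_into_left)
  have [simp]: "b (b' x) = x" if "x \<in> E" for x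
    using b that by (auto simp: b'_def bij_betw_inv_into_right)
  have bE: "b i \<in> E" if "i \<in> {1..n}" for i
    using b that by (meson bij_betwE)
  define h where "h = (\<lambda>g i. if i \<in> {1..n} then b' (\<phi> g (b i)) else i)"
  have mem: "h g i \<in> {1..n}" if "g \<in> carrier G" "i \<in> {1..n}" for g i
    using that bE element_image [OF that(1) bE [OF that(2)] refl] b' by (auto simp: h_def dest: bij_betwE)
  have bij: "bij_betw (h g) {1..n} {1..n}" if "g \<in> carrier G" for g
  proof -
    have "bij_betw (\<phi> g) E E"
      using that inj_prop surj_prop by (simp add: bij_betw_def)
    then have "bij_betw (b' \<circ> (\<phi> g \<circ> b)) {1..n} {1..n}"
      using bij_betw_trans [OF bij_betw_trans [OF b] b'] by blast
    moreover have "h g i = (b' \<circ> (\<phi> g \<circ> b)) i" if "i \<in> {1..n}" for i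
      using that by (simp add: h_def)
    ultimately show ?thesis
      by (metis (no_types, lifting) bij_betw_cong)
  qed
  show thesis
  proof (rule that [of h])
    show "h \<in> hom G (sym_group n)"
    proof (rule homI)
      show "h g \<in> carrier (sym_group n)" if "g \<in> carrier G" for g
        using bij [OF that] by (auto simp: sym_group_def h_def intro: bij_imp_permutes)
      show "h (g \<otimes> k) = h g \<otimes>\<^bsub>sym_group n\<^esub> h k" if "g \<in> carrier G" "k \<in> carrier G" for g k
      proof
        fix i
        have "\<phi> k (b i) \<in> E" if "i \<in> {1..n}"
          using element_image [OF \<open>k \<in> carrier G\<close> bE [OF that] refl] .
        then show "h (g \<otimes> k) i = (h g \<otimes>\<^bsub>sym_group n\<^esub> h k) i"
          using that bE mem [OF that(2), of i] by (auto simp: sym_group_def h_def composition_rule)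
      qed
    qed
    show "\<phi> g x = x" if "g \<in> carrier G" "h g = id" "x \<in> E" for g x
    proof -
      have i: "b' x \<in> {1..n}"
        using b' that(3) by (meson bij_betwE)
      have "\<phi> g x \<in> E"
        using element_image that by blast
      moreover have "b' (\<phi> g x) = b' x"
        using fun_cong [OF that(2), of "b' x"] i that(3) by (simp add: h_def)
      ultimately show ?thesis
        using that(3) by (metis \<open>\<And>x. x \<in> E \<Longrightarrow> b (b' x) = x\<close>)
    qed
  qed
qed

lemma (in group) iso_sym_group_product:
  assumes E: "group_action G E \<phi>" "finite E" "card E = m"
    and F: "group_action G F \<psi>" "finite F" "card F = n"
    and order: "order G = fact m * fact n"
    and faithful: "\<And>g. g \<in> carrier G \<Longrightarrow> \<forall>x\<in>E. \<phi> g x = x \<Longrightarrow> \<forall>x\<in>F. \<psi> g x = x \<Longrightarrow> g = \<one>"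
  shows "G \<cong> sym_group m \<times>\<times> sym_group n"
proof -
  obtain h where h: "h \<in> hom G (sym_group m)"
    "\<And>g x. g \<in> carrier G \<Longrightarrow> h g = id \<Longrightarrow> x \<in> E \<Longrightarrow> \<phi> g x = x"
    using group_action.hom_to_sym_group [OF E(1) E(3,2)] by blast
  obtain k where k: "k \<in> hom G (sym_group n)"
    "\<And>g x. g \<in> carrier G \<Longrightarrow> k g = id \<Longrightarrow> x \<in> F \<Longrightarrow> \<psi> g x = x"
    using group_action.hom_to_sym_group [OF F(1) F(3,2)] by blast
  let ?S = "sym_group m \<times>\<times> sym_group n"
  let ?f = "\<lambda>g. (h g, k g)"
  have hom: "?f \<in> hom G ?S"
    using h(1) k(1) by (simp add: hom_paired)
  interpret group_hom G ?S ?f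
    using hom by (simp add: group_hom_def group_hom_axioms_def DirProd_group sym_group_is_group)
  have inj: "inj_on ?f (carrier G)"
    unfolding inj_on_one_iff
  proof (intro allI impI)
    fix g assume "g \<in> carrier G" "?f g = \<one>\<^bsub>?S\<^esub>"
    then show "g = \<one>"
      using h(2) k(2) faithful by (auto simp: sym_group_one)
  qed
  have card: "card (carrier ?S) = order G"
    using order by (simp add: card_cartesian_product sym_group_card_carrier)
  have "0 < card (carrier ?S)"
    by (simp add: card_cartesian_product sym_group_card_carrier)
  then have "finite (carrier ?S)"
    by (rule card_ge_0_finite)
  then have "?f ` carrier G = carrier ?S"
    using inj hom card by (intro card_subset_eq) (auto simp: hom_def card_image order_def)
  then have "?f \<in> iso G ?S"
    using hom inj by (simp add: iso_def bij_betw_def)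
  then show ?thesis
    by (rule is_isoI)
qed

section \<open>Elements supplied by the groups of order 12\<close>

lemma embeds_inE:
  assumes "embeds_in K G" "group G"
  obtains h where "h \<in> hom K G" "inj_on h (carrier K)"
proof -
  obtain H h where H: "subgroup H G" and h: "h \<in> iso K (G\<lparr>carrier := H\<rparr>)"
    using assms(1) by (auto simp: embeds_in_def is_iso_def)
  have "h \<in> hom K G"
    using h subgroup.subset [OF H] by (auto simp: iso_def hom_def)
  moreover have "inj_on h (carrier K)"
    using h by (simp add: iso_def bij_betw_def)
  ultimately show thesis
    by (rule that)
qed

text \<open>
  Three of the groups of order 12 are semidirect products of the integers modulo 3 with a group \<open>T\<close> of
  order 4 that acts through a sign character. The trivial character on a cyclic \<open>T\<close> gives the cyclic group,
  the nontrivial one gives the dicyclic group, and a nontrivial character on a Klein group gives the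
  dihedral group.
\<close>

definition semidirect_Z3 :: "('t \<Rightarrow> int) \<Rightarrow> ('t, 'm) monoid_scheme \<Rightarrow> (int \<times> 't) monoid"
  where "semidirect_Z3 \<chi> T =
    \<lparr>carrier = {0..<3} \<times> carrier T,
     monoid.mult = (\<lambda>(i, s) (j, t). ((i + \<chi> s * j) mod 3, s \<otimes>\<^bsub>T\<^esub> t)),
     one = (0, \<one>\<^bsub>T\<^esub>)\<rparr>"

lemma group_semidirect_Z3:
  assumes "group T" and \<chi>: "\<chi> \<in> hom T sign_img"
  shows "group (semidirect_Z3 \<chi> T)"
proof -
  interpret T: group T by fact
  interpret \<chi>: group_hom T sign_img \<chi>
    using assms by (simp add: group_hom_def group_hom_axioms_def sign_img_is_group)
  have mult: "\<chi> (s \<otimes>\<^bsub>T\<^esub> t) = \<chi> s * \<chi> t" if "s \<in> carrier T" "t \<in> carrier T" for s t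
    using \<chi>.hom_mult [OF that] by (simp add: sign_img_def)
  have one: "\<chi> \<one>\<^bsub>T\<^esub> = 1"
    using \<chi>.hom_one by (simp add: sign_img_def)
  have sq: "\<chi> s * \<chi> s = 1" if "s \<in> carrier T" for s
    using \<chi>.hom_closed [OF that] by (auto simp: sign_img_def)
  have inv: "\<chi> (inv\<^bsub>T\<^esub> s) = \<chi> s" if "s \<in> carrier T" for s
  proof -
    have "\<chi> (inv\<^bsub>T\<^esub> s) * \<chi> s = 1"
      using mult [of "inv\<^bsub>T\<^esub> s" s] that one by simp
    then show ?thesis
      using sq [OF that] by (metis mult.assoc mult.left_neutral mult.right_neutral)
  qed
  show ?thesis
  proof (rule groupI)
    fix x y z
    assume "x \<in> carrier (semidirect_Z3 \<chi> T)" "y \<in> carrier (semidirect_Z3 \<chi> T)"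
      "z \<in> carrier (semidirect_Z3 \<chi> T)"
    then obtain i r j s k t where *: "x = (i, r)" "y = (j, s)" "z = (k, t)"
      "r \<in> carrier T" "s \<in> carrier T" "t \<in> carrier T"
      by (auto simp: semidirect_Z3_def)
    have eq: "((i + \<chi> r * j) mod 3 + \<chi> r * \<chi> s * k) mod 3 = (i + \<chi> r * ((j + \<chi> s * k) mod 3)) mod 3"
    proof -
      have "((i + \<chi> r * j) mod 3 + \<chi> r * \<chi> s * k) mod 3 = (i + \<chi> r * (j + \<chi> s * k)) mod 3"
        by (simp only: mod_add_left_eq) (simp add: algebra_simps)
      also have "\<dots> = (i + \<chi> r * ((j + \<chi> s * k) mod 3)) mod 3"
        by (intro mod_add_cong mod_mult_cong) simp_all
      finally show ?thesis .
    qed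
    then show "x \<otimes>\<^bsub>semidirect_Z3 \<chi> T\<^esub> y \<otimes>\<^bsub>semidirect_Z3 \<chi> T\<^esub> z =
      x \<otimes>\<^bsub>semidirect_Z3 \<chi> T\<^esub> (y \<otimes>\<^bsub>semidirect_Z3 \<chi> T\<^esub> z)"
      by (simp only: * semidirect_Z3_def monoid.select_convs case_prod_conv mult T.m_assoc eq T.m_closed)
  next
    fix x assume "x \<in> carrier (semidirect_Z3 \<chi> T)"
    then obtain i s where x: "x = (i, s)" "s \<in> carrier T" "0 \<le> i" "i < 3"
      by (auto simp: semidirect_Z3_def)
    have "((- \<chi> s * i) mod 3, inv\<^bsub>T\<^esub> s) \<otimes>\<^bsub>semidirect_Z3 \<chi> T\<^esub> x = \<one>\<^bsub>semidirect_Z3 \<chi> T\<^esub>"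
      using x by (simp add: semidirect_Z3_def inv mod_add_left_eq del: \<chi>.hom_inv)
    moreover have "((- \<chi> s * i) mod 3, inv\<^bsub>T\<^esub> s) \<in> carrier (semidirect_Z3 \<chi> T)"
      using x by (simp add: semidirect_Z3_def)
    ultimately show "\<exists>y\<in>carrier (semidirect_Z3 \<chi> T). y \<otimes>\<^bsub>semidirect_Z3 \<chi> T\<^esub> x = \<one>\<^bsub>semidirect_Z3 \<chi> T\<^esub>"
      by blast
    show "\<one>\<^bsub>semidirect_Z3 \<chi> T\<^esub> \<otimes>\<^bsub>semidirect_Z3 \<chi> T\<^esub> x = x"
      using x by (simp add: semidirect_Z3_def one del: \<chi>.hom_one)
  qed (auto simp: semidirect_Z3_def)
qed

lemma semidirect_Z3_elements:
  fixes G :: "('a, 'b) monoid_scheme"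
  assumes G: "group G" and all: "all_groups_of_order_embed_in 12 G"
    and T: "group T" "order T = 4" and \<chi>: "\<chi> \<in> hom T sign_img"
  obtains \<sigma> f where "\<sigma> \<in> carrier G" "\<sigma> \<noteq> \<one>\<^bsub>G\<^esub>" "\<sigma> [^]\<^bsub>G\<^esub> (3::nat) = \<one>\<^bsub>G\<^esub>"
    "f \<in> hom T G" "inj_on f (carrier T)"
    "\<And>t. t \<in> carrier T \<Longrightarrow> \<chi> t = 1 \<Longrightarrow> group.conj_by G (f t) \<sigma> = \<sigma>"
    "\<And>t. t \<in> carrier T \<Longrightarrow> \<chi> t = -1 \<Longrightarrow> group.conj_by G (f t) \<sigma> = inv\<^bsub>G\<^esub> \<sigma>"
proof -
  interpret G: group G by fact
  interpret T: group T by fact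
  let ?K = "semidirect_Z3 \<chi> T"
  interpret K: group ?K
    using T(1) \<chi> by (rule group_semidirect_Z3)
  have "order ?K = 12"
    using T(2) by (simp add: semidirect_Z3_def order_def card_cartesian_product)
  then have "embeds_in ?K G"
    using all_groups_of_order_embed_inD [OF all _ K.group_axioms] by simp
  then obtain h where h: "h \<in> hom ?K G" "inj_on h (carrier ?K)"
    using G by (rule embeds_inE)
  interpret h: group_hom ?K G h
    using h(1) by (simp add: group_hom_def group_hom_axioms_def)
  have one: "\<chi> \<one>\<^bsub>T\<^esub> = 1"
    using hom_one [OF \<chi> T(1) sign_img_is_group] by (simp add: sign_img_def)
  let ?s = "(1, \<one>\<^bsub>T\<^esub>)" and ?f = "\<lambda>t. h (0, t)"
  have s: "?s \<in> carrier ?K"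
    by (simp add: semidirect_Z3_def)
  have t: "(0, t) \<in> carrier ?K" if "t \<in> carrier T" for t
    using that by (simp add: semidirect_Z3_def)
  have s2: "?s \<otimes>\<^bsub>?K\<^esub> ?s = (2, \<one>\<^bsub>T\<^esub>)"
    by (simp add: semidirect_Z3_def one)
  have s3: "?s \<otimes>\<^bsub>?K\<^esub> ?s \<otimes>\<^bsub>?K\<^esub> ?s = \<one>\<^bsub>?K\<^esub>"
    by (simp add: semidirect_Z3_def one)
  show thesis
  proof (rule that [of "h ?s" ?f])
    show "h ?s \<in> carrier G"
      using s by simp
    show "h ?s \<noteq> \<one>\<^bsub>G\<^esub>"
    proof -
      have "?s \<noteq> \<one>\<^bsub>?K\<^esub>"
        by (simp add: semidirect_Z3_def)
      then show ?thesis
        using h(2) s unfolding h.inj_on_one_iff by blast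
    qed
    have hs3: "h ?s \<otimes>\<^bsub>G\<^esub> h ?s \<otimes>\<^bsub>G\<^esub> h ?s = \<one>\<^bsub>G\<^esub>"
      using s s3 by (simp add: h.hom_mult [symmetric] del: h.hom_mult)
    then show "h ?s [^]\<^bsub>G\<^esub> (3::nat) = \<one>\<^bsub>G\<^esub>"
      using s by (simp add: numeral_3_eq_3)
    show "?f \<in> hom T G"
    proof (rule homI)
      fix x y assume xy: "x \<in> carrier T" "y \<in> carrier T"
      then have "(0, x \<otimes>\<^bsub>T\<^esub> y) = (0, x) \<otimes>\<^bsub>?K\<^esub> (0, y)"
        by (simp add: semidirect_Z3_def)
      then show "h (0, x \<otimes>\<^bsub>T\<^esub> y) = h (0, x) \<otimes>\<^bsub>G\<^esub> h (0, y)"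
        using xy t by simp
    qed (simp add: t)
    show "inj_on ?f (carrier T)"
      using h(2) t by (auto simp: inj_on_def)
    fix u assume u: "u \<in> carrier T"
    show "G.conj_by (?f u) (h ?s) = h ?s" if "\<chi> u = 1"
    proof -
      have "(0, u) \<otimes>\<^bsub>?K\<^esub> ?s = ?s \<otimes>\<^bsub>?K\<^esub> (0, u)"
        using u that by (simp add: semidirect_Z3_def)
      then show ?thesis
        using u s t by (simp add: G.conj_eq_iff h.hom_mult [symmetric] del: h.hom_mult)
    qed
    show "G.conj_by (?f u) (h ?s) = inv\<^bsub>G\<^esub> h ?s" if "\<chi> u = -1"
    proof -
      have "inv\<^bsub>G\<^esub> h ?s = h ?s \<otimes>\<^bsub>G\<^esub> h ?s"
        using hs3 s by (simp add: G.inv_equality)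
      moreover have "(0, u) \<otimes>\<^bsub>?K\<^esub> ?s = ?s \<otimes>\<^bsub>?K\<^esub> ?s \<otimes>\<^bsub>?K\<^esub> (0, u)"
        using u that one by (simp add: semidirect_Z3_def)
      ultimately show ?thesis
        using u s t by (simp add: G.conj_eq_iff h.hom_mult [symmetric] del: h.hom_mult)
    qed
  qed
qed

lemma (in group) Z12_elements:
  assumes all: "all_groups_of_order_embed_in 12 G"
  obtains x u where "x \<in> carrier G" "x \<noteq> \<one>" "x [^] (3::nat) = \<one>"
    "u \<in> carrier G" "u [^] (2::nat) \<noteq> \<one>" "u [^] (4::nat) = \<one>" "u \<rhd> x = x"
proof -
  let ?T = "integer_mod_group 4"
  have T: "group ?T" "order ?T = 4"
    by (simp_all add: order_def carrier_integer_mod_group)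
  let ?\<chi> = "\<lambda>_::int. 1 :: int"
  have \<chi>: "?\<chi> \<in> hom ?T sign_img"
    by (auto simp: hom_def sign_img_def)
  obtain x f where x: "x \<in> carrier G" "x \<noteq> \<one>" "x [^] (3::nat) = \<one>"
    and f: "f \<in> hom ?T G" "inj_on f (carrier ?T)"
      "\<And>t. t \<in> carrier ?T \<Longrightarrow> ?\<chi> t = 1 \<Longrightarrow> f t \<rhd> x = x"
      "\<And>t. t \<in> carrier ?T \<Longrightarrow> ?\<chi> t = - 1 \<Longrightarrow> f t \<rhd> x = inv x"
    by (rule semidirect_Z3_elements [OF group_axioms all T \<chi>]) (rule that)
  interpret f: group_hom ?T G f
    using f(1) by (simp add: group_hom_def group_hom_axioms_def)
  have 1: "1 \<in> carrier ?T"
    by simp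
  show thesis
  proof (rule that [of x "f 1"])
    show "f 1 [^] (2::nat) \<noteq> \<one>"
      using 1 f.inj_on_one_iff f(2)
      by (auto simp: f.hom_nat_pow [symmetric] carrier_integer_mod_group dest: spec [of _ 2])
    show "f 1 [^] (4::nat) = \<one>"
      using 1 by (simp add: f.hom_nat_pow [symmetric] del: integer_mod_group_1) (metis f.hom_one one_integer_mod_group)
  qed (use x f 1 in auto)
qed

lemma (in group) Dic3_elements:
  assumes all: "all_groups_of_order_embed_in 12 G"
  obtains s w where "s \<in> carrier G" "s \<noteq> \<one>" "s [^] (3::nat) = \<one>"
    "w \<in> carrier G" "w [^] (2::nat) \<noteq> \<one>" "w [^] (4::nat) = \<one>" "w \<rhd> s = inv s"
proof -
  let ?T = "integer_mod_group 4" and ?\<chi> = "\<lambda>i::int. if even i then 1 else - 1 :: int"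
  have T: "group ?T" "order ?T = 4"
    by (simp_all add: order_def carrier_integer_mod_group)
  have "even (i mod 4) \<longleftrightarrow> even i" for i :: int
    by (simp add: dvd_mod_iff)
  then have \<chi>: "?\<chi> \<in> hom ?T sign_img"
    by (auto simp: hom_def sign_img_def)
  obtain s f where s: "s \<in> carrier G" "s \<noteq> \<one>" "s [^] (3::nat) = \<one>"
    and f: "f \<in> hom ?T G" "inj_on f (carrier ?T)"
      "\<And>t. t \<in> carrier ?T \<Longrightarrow> ?\<chi> t = 1 \<Longrightarrow> f t \<rhd> s = s"
      "\<And>t. t \<in> carrier ?T \<Longrightarrow> ?\<chi> t = - 1 \<Longrightarrow> f t \<rhd> s = inv s"
    by (rule semidirect_Z3_elements [OF group_axioms all T \<chi>]) (rule that)
  interpret f: group_hom ?T G f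
    using f(1) by (simp add: group_hom_def group_hom_axioms_def)
  have 1: "1 \<in> carrier ?T"
    by simp
  show thesis
  proof (rule that [of s "f 1"])
    show "f 1 [^] (2::nat) \<noteq> \<one>"
      using 1 f.inj_on_one_iff f(2)
      by (auto simp: f.hom_nat_pow [symmetric] carrier_integer_mod_group dest: spec [of _ 2])
    show "f 1 [^] (4::nat) = \<one>"
      using 1 by (simp add: f.hom_nat_pow [symmetric] del: integer_mod_group_1) (metis f.hom_one one_integer_mod_group)
  qed (use s f 1 in auto)
qed

lemma (in group) D6_elements:
  assumes all: "all_groups_of_order_embed_in 12 G"
  obtains s t where "s \<in> carrier G" "s \<noteq> \<one>" "s [^] (3::nat) = \<one>"
    "t \<in> carrier G" "t [^] (2::nat) = \<one>" "t \<rhd> s = inv s"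
proof -
  let ?T = "integer_mod_group 2 \<times>\<times> integer_mod_group 2"
    and ?\<chi> = "\<lambda>p::int \<times> int. if even (fst p) then 1 else - 1 :: int"
  have T: "group ?T" "order ?T = 4"
    by (simp_all add: order_def carrier_integer_mod_group DirProd_group card_cartesian_product)
  have "even (i mod 2) \<longleftrightarrow> even i" for i :: int
    by (simp add: dvd_mod_iff)
  then have \<chi>: "?\<chi> \<in> hom ?T sign_img"
    by (auto simp: hom_def sign_img_def)
  obtain s f where s: "s \<in> carrier G" "s \<noteq> \<one>" "s [^] (3::nat) = \<one>"
    and f: "f \<in> hom ?T G" "inj_on f (carrier ?T)"
      "\<And>t. t \<in> carrier ?T \<Longrightarrow> ?\<chi> t = 1 \<Longrightarrow> f t \<rhd> s = s"
      "\<And>t. t \<in> carrier ?T \<Longrightarrow> ?\<chi> t = - 1 \<Longrightarrow> f t \<rhd> s = inv s"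
    by (rule semidirect_Z3_elements [OF group_axioms all T \<chi>]) (rule that)
  interpret f: group_hom ?T G f
    using f(1) T by (simp add: group_hom_def group_hom_axioms_def)
  have t: "(1, 0) \<in> carrier ?T" and t2: "(1, 0) \<otimes>\<^bsub>?T\<^esub> (1, 0) = \<one>\<^bsub>?T\<^esub>"
    by simp_all
  show thesis
  proof (rule that [of s "f (1, 0)"])
    show "f (1, 0) [^] (2::nat) = \<one>"
    proof -
      have "f (1, 0) \<otimes> f (1, 0) = \<one>"
        unfolding f.hom_mult [OF t t, symmetric] t2 by (rule f.hom_one)
      then show ?thesis
        using f.hom_closed [OF t] by (simp add: numeral_2_eq_2)
    qed
  qed (use s f t in \<open>auto simp del: carrier_DirProd\<close>)
qed

text \<open>
  The last equation says that \<open>a\<close> and its two conjugates by powers of \<open>y\<close> multiply to the identity.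
  Together with the orders of \<open>a\<close> and \<open>y\<close> it is all that is needed to reconstruct the Klein subgroup
  and the action of \<open>y\<close> on it.
\<close>

lemma (in group) A4_elements:
  assumes all: "all_groups_of_order_embed_in 12 G"
  obtains a y where "a \<in> carrier G" "y \<in> carrier G" "a \<noteq> \<one>" "a \<otimes> a = \<one>"
    "y [^] (3::nat) = \<one>" "y \<rhd> y \<rhd> a = a \<otimes> (y \<rhd> a)"
proof -
  let ?A = "alt_group 4"
  interpret A: group ?A
    by (rule alt_group_is_group)
  have "order ?A = 12"
    using alt_group_card_carrier [of 4] by (simp add: order_def fact_numeral)
  then have "embeds_in ?A G"
    using all_groups_of_order_embed_inD [OF all _ A.group_axioms] by simp
  then obtain h where h: "h \<in> hom ?A G" "inj_on h (carrier ?A)"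
    using group_axioms by (rule embeds_inE)
  interpret h: group_hom ?A G h
    using h(1) by (simp add: group_hom_def group_hom_axioms_def)
  define a y where ay: "a = transpose (1::nat) 2 \<circ> transpose 3 4" "y = transpose (1::nat) 2 \<circ> transpose 2 3"
  have a: "a \<in> carrier ?A" and y: "y \<in> carrier ?A"
    unfolding ay alt_group_carrier
    by (auto intro!: permutes_compose permutes_swap_id simp: evenperm_comp evenperm_swap permutation_swap_id)
  have "a 1 \<noteq> id 1"
    by (simp add: ay)
  then have a1: "a \<noteq> \<one>\<^bsub>?A\<^esub>"
    by (auto simp: alt_group_one)
  have a_simps: "a 1 = 2" "a 2 = 1" "a 3 = 4" "a 4 = 3" "i \<notin> {1, 2, 3, 4} \<Longrightarrow> a i = i"
    and y_simps: "y 1 = 2" "y 2 = 3" "y 3 = 1" "y 4 = 4" "i \<notin> {1, 2, 3, 4} \<Longrightarrow> y i = i" for i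
    by (simp_all add: ay transpose_def)
  have eqI: "p = q" if "p 1 = q 1" "p 2 = q 2" "p 3 = q 3" "p 4 = q 4"
    "\<And>i. i \<notin> {1, 2, 3, 4} \<Longrightarrow> p i = q i" for p q :: "nat \<Rightarrow> nat"
    using that by (metis (full_types) empty_iff ext insert_iff)
  have a2: "a \<otimes>\<^bsub>?A\<^esub> a = \<one>\<^bsub>?A\<^esub>"
    by (rule eqI) (simp_all add: alt_group_mult alt_group_one a_simps [simplified] y_simps [simplified])
  have y3: "y \<otimes>\<^bsub>?A\<^esub> y \<otimes>\<^bsub>?A\<^esub> y = \<one>\<^bsub>?A\<^esub>"
    by (rule eqI) (simp_all add: alt_group_mult alt_group_one a_simps [simplified] y_simps [simplified])
  have yay: "y \<otimes>\<^bsub>?A\<^esub> y \<otimes>\<^bsub>?A\<^esub> a \<otimes>\<^bsub>?A\<^esub> y = a \<otimes>\<^bsub>?A\<^esub> y \<otimes>\<^bsub>?A\<^esub> a \<otimes>\<^bsub>?A\<^esub> y \<otimes>\<^bsub>?A\<^esub> y"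
    by (rule eqI) (simp_all add: alt_group_mult a_simps [simplified] y_simps [simplified])
  have hy3: "h y \<otimes> h y \<otimes> h y = \<one>"
    using y y3 by (simp add: h.hom_mult [symmetric] del: h.hom_mult)
  have inv: "inv (h y) = h y \<otimes> h y"
    using y hy3 by (intro inv_equality) auto
  have hyay: "h y \<otimes> h y \<otimes> h a \<otimes> h y = h a \<otimes> h y \<otimes> h a \<otimes> h y \<otimes> h y"
    using a y yay by (simp add: h.hom_mult [symmetric] del: h.hom_mult)
  show thesis
  proof (rule that [of "h a" "h y"])
    show "h a \<noteq> \<one>"
      using h.inj_on_one_iff h(2) a a1 by blast
    show "h a \<otimes> h a = \<one>"
      using a a2 by (simp add: h.hom_mult [symmetric] del: h.hom_mult)
    show "h y [^] (3::nat) = \<one>"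
      using y hy3 by (simp add: numeral_3_eq_3)
    have "h y \<rhd> h y \<rhd> h a = h y \<otimes> h y \<otimes> h a \<otimes> h y \<otimes> (h y \<otimes> h y \<otimes> h y)"
      using a y by (simp add: conj_by_def inv m_assoc)
    also have "\<dots> = h a \<otimes> (h y \<rhd> h a)"
      using a y by (simp only: hy3 hyay) (simp add: conj_by_def inv m_assoc)
    finally show "h y \<rhd> h y \<rhd> h a = h a \<otimes> (h y \<rhd> h a)" .
  qed (use a y in auto)
qed

section \<open>The copy of the alternating group and the normalizer of a Sylow 3-subgroup\<close>

text \<open>
  The elements \<open>a\<close> and \<open>y\<close> generate a copy of the alternating group of degree 4, placed so that the Sylow
  3-subgroup \<open>P\<close> contains \<open>y\<close>. The last assumption is what Burnside's fusion lemma extracts from the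
  dihedral subgroup of order 12.
\<close>

locale order_144_with_A4 = group G for G (structure) +
  fixes a y P
  assumes order_G: "order G = 144"
    and a_closed [simp]: "a \<in> carrier G" and a_neq_one: "a \<noteq> \<one>" and a_sq: "a \<otimes> a = \<one>"
    and y_cube: "y [^] (3::nat) = \<one>" and y_y_a: "y \<rhd> y \<rhd> a = a \<otimes> (y \<rhd> a)"
    and P_subgroup: "subgroup P G" and card_P: "card P = 9" and y_in_P [simp]: "y \<in> P"
    and inverted: "\<exists>n \<in> normalizer G P. \<exists>x \<in> P. x \<noteq> \<one> \<and> n \<rhd> x = inv x"
begin

lemma finite_G: "finite (carrier G)"
  using order_G by (metis card.infinite order_def zero_neq_numeral)

lemma P_closed [simp]: "p \<in> P \<Longrightarrow> p \<in> carrier G"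
  using P_subgroup by (rule subgroup.mem_carrier)

lemma P_mult [simp]: "p \<in> P \<Longrightarrow> q \<in> P \<Longrightarrow> p \<otimes> q \<in> P"
  and P_inv [simp]: "p \<in> P \<Longrightarrow> inv p \<in> P"
  and P_one [simp]: "\<one> \<in> P"
  using P_subgroup by (auto simp: subgroup.m_closed subgroup.m_inv_closed subgroup.one_closed)

lemma P_pow [simp]: "p \<in> P \<Longrightarrow> p [^] (k::nat) \<in> P"
  by (induction k) auto

lemma prime_3: "Factorial_Ring.prime (3::nat)"
  by simp

lemma P_commute: "p \<in> P \<Longrightarrow> q \<in> P \<Longrightarrow> p \<otimes> q = q \<otimes> p"
  using prime_square_subgroup_commute [OF P_subgroup prime_3] card_P by simp

lemma P_conj [simp]: "p \<in> P \<Longrightarrow> q \<in> P \<Longrightarrow> p \<rhd> q = q"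
  by (simp add: conj_eq_iff P_commute)

lemma P_pow_9: "p \<in> P \<Longrightarrow> p [^] (9::nat) = \<one>"
proof -
  assume p: "p \<in> P"
  interpret P: group "G\<lparr>carrier := P\<rparr>"
    using P_subgroup by (rule subgroup_imp_group)
  show ?thesis
    using P.pow_order_eq_1 [of p] p card_P by (simp add: order_def nat_pow_consistent [symmetric])
qed

lemma P_no_involution: "p \<in> P \<Longrightarrow> p \<otimes> p = \<one> \<Longrightarrow> p = \<one>"
proof -
  assume p: "p \<in> P" "p \<otimes> p = \<one>"
  have "p [^] (9::nat) = (p \<otimes> p) [^] (4::nat) \<otimes> p"
    using p(1) by (simp add: numeral_eq_Suc m_assoc)
  then show "p = \<one>"
    using p by (simp add: P_pow_9)
qed

lemma P_eq_inv: "p \<in> P \<Longrightarrow> p = inv p \<Longrightarrow> p = \<one>"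
  by (metis P_closed P_no_involution r_inv)

definition b where "b = y \<rhd> a"
definition c where "c = a \<otimes> b"
definition V where "V = {\<one>, a, b, c}"

lemma b_closed [simp]: "b \<in> carrier G" and c_closed [simp]: "c \<in> carrier G"
  by (simp_all add: b_def c_def)

lemma V_closed [simp]: "v \<in> V \<Longrightarrow> v \<in> carrier G"
  by (auto simp: V_def)

lemma y_b: "y \<rhd> b = c" and y_a: "y \<rhd> a = b"
  using y_y_a by (simp_all add: b_def c_def)

lemma y_c: "y \<rhd> c = a"
proof -
  have "y \<rhd> y \<rhd> y \<rhd> a = (y [^] (3::nat)) \<rhd> a"
    by (simp add: numeral_3_eq_3 conj_conj)
  then show ?thesis
    by (simp add: y_cube y_b y_a)
qed

lemma inv_y_shift: "inv y \<rhd> b = a" "inv y \<rhd> c = b" "inv y \<rhd> a = c"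
  using y_a y_b y_c by (metis P_closed a_closed b_closed c_closed conj_inv_cancel(1) y_in_P)+

lemma b_sq: "b \<otimes> b = \<one>" and c_sq: "c \<otimes> c = \<one>"
proof -
  show b: "b \<otimes> b = \<one>"
    by (simp add: b_def conj_mult [symmetric] a_sq)
  have "c \<otimes> c = y \<rhd> (b \<otimes> b)"
    by (simp add: conj_mult y_b)
  then show "c \<otimes> c = \<one>"
    by (simp add: b)
qed

lemma V_inv: "inv a = a" "inv b = b" "inv c = c"
  by (simp_all add: a_sq b_sq c_sq inv_equality)

lemma V_neq: "b \<noteq> \<one>" "c \<noteq> \<one>" "a \<noteq> b" "a \<noteq> c" "b \<noteq> c"
proof -
  show b: "b \<noteq> \<one>"
    using a_neq_one by (simp add: b_def)
  then show c: "c \<noteq> \<one>"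
    using y_b by (metis P_closed b_closed conj_eq_one_iff y_in_P)
  show "a \<noteq> b" "a \<noteq> c" "b \<noteq> c"
    using a_neq_one b c a_sq by (auto simp: c_def)
qed

lemma V_products: "a \<otimes> b = c" "b \<otimes> a = c" "b \<otimes> c = a" "c \<otimes> b = a" "a \<otimes> c = b" "c \<otimes> a = b"
proof -
  show ab: "a \<otimes> b = c"
    by (simp add: c_def)
  show ba: "b \<otimes> a = c"
    by (metis V_inv ab a_closed b_closed inv_mult_group)
  show "b \<otimes> c = a" "a \<otimes> c = b"
    by (metis ab ba m_assoc a_sq b_sq a_closed b_closed l_one)+
  show "c \<otimes> b = a" "c \<otimes> a = b"
    by (metis ab ba m_assoc a_sq b_sq a_closed b_closed r_one)+
qed

lemma V_mult [simp]: "v \<in> V \<Longrightarrow> w \<in> V \<Longrightarrow> v \<otimes> w \<in> V"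
  by (auto simp: V_def V_products a_sq b_sq c_sq)

lemma V_sq: "v \<in> V \<Longrightarrow> v \<otimes> v = \<one>"
  by (auto simp: V_def a_sq b_sq c_sq)

lemma V_inv_eq [simp]: "v \<in> V \<Longrightarrow> inv v = v"
  by (auto simp: V_def V_inv)

lemma card_V: "card V = 4"
  using V_neq a_neq_one by (simp add: V_def)

lemma V_conj_sq: "v \<in> V \<Longrightarrow> x \<in> carrier G \<Longrightarrow> v \<rhd> v \<rhd> x = x"
  by (simp add: conj_conj [symmetric] V_sq)

definition N where "N = normalizer G P"

lemma N_subgroup: "subgroup N G"
  unfolding N_def by (rule normalizer_imp_subgroup [OF subgroup.subset [OF P_subgroup]])

lemma N_closed [simp]: "n \<in> N \<Longrightarrow> n \<in> carrier G"
  using N_subgroup by (rule subgroup.mem_carrier)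

lemma N_mult [simp]: "p \<in> N \<Longrightarrow> q \<in> N \<Longrightarrow> p \<otimes> q \<in> N"
  and N_inv [simp]: "p \<in> N \<Longrightarrow> inv p \<in> N"
  and N_one [simp]: "\<one> \<in> N"
  using N_subgroup by (auto simp: subgroup.m_closed subgroup.m_inv_closed subgroup.one_closed)

lemma N_conj_closed [simp]: "n \<in> N \<Longrightarrow> m \<in> N \<Longrightarrow> n \<rhd> m \<in> N"
  by (simp add: conj_by_def)

lemma N_iff: "g \<in> N \<longleftrightarrow> g \<in> carrier G \<and> (\<forall>p\<in>P. g \<rhd> p \<in> P)"
  unfolding N_def by (rule mem_normalizer_iff [OF P_subgroup finite_G])

lemma N_conj_P [simp]: "n \<in> N \<Longrightarrow> p \<in> P \<Longrightarrow> n \<rhd> p \<in> P"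
  by (simp add: N_iff)

lemma P_in_N [simp]: "p \<in> P \<Longrightarrow> p \<in> N"
  by (simp add: N_iff)

lemma N_cancel_left: "n \<in> N \<Longrightarrow> g \<in> carrier G \<Longrightarrow> n \<otimes> g \<in> N \<longleftrightarrow> g \<in> N"
  by (metis N_closed N_inv N_mult inv_cancel_left(1))

lemma N_conj_iff: "n \<in> N \<Longrightarrow> g \<in> carrier G \<Longrightarrow> n \<rhd> g \<in> N \<longleftrightarrow> g \<in> N"
  by (metis N_closed N_inv N_conj_closed conj_inv_cancel(1))

text \<open>
  If \<open>v\<close> normalized \<open>P\<close>, the commutator of \<open>v\<close> and \<open>y\<close> would lie in \<open>P\<close>. It also lies in \<open>V\<close> and is
  not the identity as \<open>y\<close> fixes no involution of \<open>V\<close>, whereas \<open>P\<close> has odd order.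
\<close>

lemma V_inter_N: "v \<in> V \<Longrightarrow> v \<in> N \<Longrightarrow> v = \<one>"
proof (rule ccontr)
  assume v: "v \<in> V" "v \<in> N" "v \<noteq> \<one>"
  let ?w = "v \<otimes> (y \<rhd> v)"
  have "?w = (v \<rhd> y) \<otimes> inv y"
    using v(1) by (simp add: conj_by_def m_assoc)
  moreover have "v \<rhd> y \<in> P"
    using v(2) by simp
  ultimately have "?w \<in> P"
    by simp
  moreover have "?w \<in> V" "?w \<noteq> \<one>"
    using v(1,3) V_neq a_neq_one by (auto simp: V_def y_a y_b y_c V_products)
  ultimately show False
    using V_sq P_no_involution by blast
qed

lemma inj_VN: "inj_on (\<lambda>(v, n). v \<otimes> n) (V \<times> N)"
proof (rule inj_onI, clarify)
  fix v n w m assume *: "v \<in> V" "n \<in> N" "w \<in> V" "m \<in> N" "v \<otimes> n = w \<otimes> m"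
  have "w \<otimes> v = m \<otimes> inv n"
  proof -
    have "w \<otimes> v = w \<otimes> (v \<otimes> n) \<otimes> inv n"
      using *(1-4) by (simp add: m_assoc)
    also have "\<dots> = w \<otimes> (w \<otimes> m) \<otimes> inv n"
      using * by simp
    also have "\<dots> = m \<otimes> inv n"
      using * by (simp add: m_assoc [symmetric] V_sq)
    finally show ?thesis .
  qed
  then have "w \<otimes> v \<in> N"
    using * by simp
  then have "w \<otimes> v = \<one>"
    using V_inter_N * by simp
  then have "v = w"
    using * by (metis V_closed V_inv_eq inv_equality)
  then show "v = w \<and> n = m"
    using * by simp
qed

text \<open>
  The index of \<open>P\<close> in \<open>N\<close> is at most 4 because \<open>V\<close> meets \<open>N\<close> trivially, and it is congruent to 16
  modulo 3. It is not 1 since some element of \<open>N\<close> does not commute with \<open>P\<close>.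
\<close>

lemma card_N: "card N = 36"
proof -
  have "card (V \<times> N) \<le> card (carrier G)"
    using inj_VN _ finite_G by (rule card_inj_on_le) auto
  then have le: "card N \<le> 36"
    using order_G by (simp add: card_cartesian_product card_V order_def)
  obtain k where k: "card N = 9 * k"
    using sylow_index_cong_normalizer_index(2) [OF finite_G P_subgroup prime_3, of 2] card_P
    by (auto simp: N_def)
  have "[16 = k] (mod 3)"
    using sylow_index_cong_normalizer_index(1) [OF finite_G P_subgroup prime_3, of 2] card_P k order_G
    by (simp add: N_def [symmetric])
  then have "k mod 3 = 1"
    by (simp add: cong_def)
  moreover have "k \<noteq> 1"
  proof
    assume "k = 1"
    then have "P = N"
      using k card_P finite_G finite_subset [OF subgroup.subset [OF N_subgroup]]
      by (intro card_subset_eq) auto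
    moreover obtain n x where "n \<in> N" "x \<in> P" "x \<noteq> \<one>" "n \<rhd> x = inv x"
      using inverted by (auto simp: N_def)
    ultimately show False
      using P_eq_inv by auto
  qed
  moreover have "k \<le> 4"
    using le k by simp
  ultimately have "k = 4"
    by presburger
  then show ?thesis
    using k by simp
qed

lemma VN_decomp:
  assumes "g \<in> carrier G"
  obtains v n where "v \<in> V" "n \<in> N" "g = v \<otimes> n"
proof -
  have "(\<lambda>(v, n). v \<otimes> n) ` (V \<times> N) = carrier G"
    using inj_VN finite_G order_G
    by (intro card_subset_eq) (auto simp: card_image card_cartesian_product card_V card_N order_def)
  then show thesis
    using assms that by (auto simp: set_eq_iff image_iff)
qed

lemma NV_decomp:
  assumes "g \<in> carrier G"
  obtains n v where "v \<in> V" "n \<in> N" "g = n \<otimes> v"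
proof -
  obtain v n where *: "v \<in> V" "n \<in> N" "inv g = v \<otimes> n"
    using assms VN_decomp [of "inv g"] by auto
  then have "g = inv n \<otimes> v"
    using assms by (metis N_closed V_closed V_inv_eq inv_inv inv_mult_group)
  then show thesis
    using * that [of v "inv n"] by simp
qed

text \<open>
  The quotient of \<open>N\<close> by \<open>P\<close> has order 4.
\<close>

lemma N_pow_4: "n \<in> N \<Longrightarrow> n [^] (4::nat) \<in> P"
proof -
  assume n: "n \<in> N"
  let ?H = "G\<lparr>carrier := N\<rparr>"
  interpret H: group ?H
    using N_subgroup by (rule subgroup_imp_group)
  have PH: "subgroup P ?H"
    by (rule subgroup_incl [OF P_subgroup N_subgroup]) auto
  have "P \<lhd> ?H"
    unfolding H.normal_inv_iff using PH m_inv_consistent [OF N_subgroup]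
    by (auto simp: conj_by_def [symmetric])
  then interpret P: normal P ?H .
  interpret Q: group "?H Mod P"
    by (rule P.factorgroup_is_group)
  have "order (?H Mod P) * card P = order ?H"
    using H.lagrange [OF PH] by (simp add: order_def FactGroup_def)
  then have "order (?H Mod P) = 4"
    by (simp add: order_def card_N card_P)
  then have pow: "(P #>\<^bsub>?H\<^esub> n) [^]\<^bsub>?H Mod P\<^esub> (4::nat) = P"
    using Q.pow_order_eq_1 [of "P #>\<^bsub>?H\<^esub> n"] n by (auto simp: carrier_FactGroup)
  have nH: "n \<in> carrier ?H"
    using n by simp
  have "P #>\<^bsub>?H\<^esub> (n [^]\<^bsub>?H\<^esub> (4::nat)) = P"
    by (rule trans [OF P.FactGroup_pow [OF nH, symmetric] pow])
  then have "n [^]\<^bsub>?H\<^esub> (4::nat) \<in> P"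
    using H.rcos_self [OF H.nat_pow_closed [OF nH] PH, of 4] by (simp only:)
  then show ?thesis
    by (simp add: nat_pow_consistent [symmetric])
qed

lemma N_3_element: "g \<in> N \<Longrightarrow> g [^] (9::nat) = \<one> \<Longrightarrow> g \<in> P"
proof -
  assume g: "g \<in> N" "g [^] (9::nat) = \<one>"
  have "(g [^] (4::nat)) [^] (2::nat) \<otimes> g = g [^] (9::nat)"
    using g(1) by (simp add: numeral_eq_Suc m_assoc)
  then have "g = inv ((g [^] (4::nat)) [^] (2::nat))"
    using g by (metis N_closed inv_comm inv_equality nat_pow_closed)
  then show "g \<in> P"
    using N_pow_4 [OF g(1)] by (metis P_inv P_pow)
qed

end

section \<open>The core of the Sylow 3-subgroup\<close>

context order_144_with_A4
begin

text \<open>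
  The core of \<open>P\<close>, that is, the intersection of all Sylow 3-subgroups.
\<close>

definition D where "D = {x \<in> carrier G. \<forall>g\<in>carrier G. g \<rhd> x \<in> P}"

lemma D_conj: "g \<in> carrier G \<Longrightarrow> d \<in> D \<Longrightarrow> g \<rhd> d \<in> D"
  unfolding D_def by (simp add: conj_conj [symmetric])

lemma D_subgroup: "subgroup D G"
proof (rule subgroupI)
  have "\<one> \<in> D"
    by (simp add: D_def)
  then show "D \<noteq> {}"
    by blast
  show "inv x \<in> D" if "x \<in> D" for x
    using that by (simp add: D_def conj_inv)
  show "x \<otimes> z \<in> D" if "x \<in> D" "z \<in> D" for x z
    using that by (simp add: D_def conj_mult)
qed (simp add: D_def subset_iff)

lemma D_in_P [simp]: "d \<in> D \<Longrightarrow> d \<in> P"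
  unfolding D_def by (metis (no_types, lifting) mem_Collect_eq one_closed one_conj)

declare D_conj [simp]

lemma D_mult [simp]: "p \<in> D \<Longrightarrow> q \<in> D \<Longrightarrow> p \<otimes> q \<in> D"
  and D_inv [simp]: "p \<in> D \<Longrightarrow> inv p \<in> D"
  and D_one [simp]: "\<one> \<in> D"
  using D_subgroup by (auto simp: subgroup.m_closed subgroup.m_inv_closed subgroup.one_closed)

lemma D_cancel_right: "d \<in> D \<Longrightarrow> g \<in> carrier G \<Longrightarrow> g \<otimes> d \<in> D \<longleftrightarrow> g \<in> D"
  by (metis P_closed D_in_P D_inv D_mult inv_solve_right)

text \<open>
  This writes conjugation by a conjugate of \<open>g\<close> through \<open>g\<close> itself, so that a fact about \<open>a\<close> passes to
  \<open>b\<close> and \<open>c\<close>, the images of \<open>a\<close> under \<open>y\<close>.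
\<close>

lemma conj_shift:
  "g \<in> carrier G \<Longrightarrow> x \<in> carrier G \<Longrightarrow> (y \<rhd> g) \<rhd> x = y \<rhd> g \<rhd> inv y \<rhd> x"
  by (simp add: conj_by_def m_assoc inv_mult_group)

lemma b_conj: "x \<in> carrier G \<Longrightarrow> b \<rhd> x = y \<rhd> a \<rhd> inv y \<rhd> x"
  and c_conj: "x \<in> carrier G \<Longrightarrow> c \<rhd> x = y \<rhd> b \<rhd> inv y \<rhd> x"
  using conj_shift [of a] conj_shift [of b] by (simp_all add: y_a y_b)

text \<open>
  An element of \<open>P\<close> that normalizes one other Sylow 3-subgroup lies in it, hence, moving it around by
  \<open>y\<close>, with which it commutes, in all of them.
\<close>

lemma mem_D_if_conj_in_N:
  assumes p: "p \<in> P" and v: "v \<in> V" "v \<noteq> \<one>" "v \<rhd> p \<in> N"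
  shows "p \<in> D"
proof -
  have bp: "b \<rhd> p = y \<rhd> a \<rhd> p" and cp: "c \<rhd> p = y \<rhd> b \<rhd> p"
    using p by (simp_all add: b_conj [of p] c_conj [of p])
  have "a \<rhd> p \<in> N"
    using v p by (auto simp: V_def bp cp N_conj_iff)
  moreover have "(a \<rhd> p) [^] (9::nat) = \<one>"
    using p by (simp add: conj_pow [symmetric] P_pow_9)
  ultimately have ap: "a \<rhd> p \<in> P"
    by (rule N_3_element)
  then have V: "w \<rhd> p \<in> P" if "w \<in> V" for w
    using that p by (auto simp: V_def bp cp)
  have "g \<rhd> p \<in> P" if g: "g \<in> carrier G" for g
  proof -
    obtain n w where "w \<in> V" "n \<in> N" "g = n \<otimes> w"
      using g by (rule NV_decomp)
    then show ?thesis
      using V p by (simp add: conj_conj)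
  qed
  then show ?thesis
    unfolding D_def using P_closed [OF p] by blast
qed

text \<open>
  Write \<open>g = nv\<close>. Then \<open>v\<close> moves \<open>x\<close> into \<open>P\<close>, so that \<open>x\<close> would be in the core unless \<open>v\<close> is trivial.
\<close>

lemma fusion_outside_D:
  assumes "x \<in> P" "x \<notin> D" "g \<in> carrier G" "g \<rhd> x \<in> P"
  shows "g \<in> N"
proof -
  obtain n v where *: "v \<in> V" "n \<in> N" "g = n \<otimes> v"
    using assms(3) by (rule NV_decomp)
  then have "n \<rhd> v \<rhd> x \<in> P"
    using assms by (simp add: conj_conj)
  then have "n \<rhd> v \<rhd> x \<in> N"
    by simp
  then have "v \<rhd> x \<in> N"
    using * assms(1) by (simp add: N_conj_iff)
  then have "v = \<one>"
    using mem_D_if_conj_in_N assms * by blast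
  then show ?thesis
    using * by simp
qed

text \<open>
  The element \<open>n\<close> permutes the three Sylow 3-subgroups other than \<open>P\<close>, on which \<open>y\<close> acts as a 3-cycle. So a
  power of \<open>y\<close> can be used to bring the image of the conjugate of \<open>P\<close> by \<open>a\<close> back to its place.
\<close>

lemma a_conj_in_N_cases:
  assumes n: "n \<in> N"
  obtains "a \<rhd> n \<in> N" | "a \<rhd> (inv y \<otimes> n) \<in> N" | "a \<rhd> (y \<otimes> n) \<in> N"
proof -
  have "n \<otimes> a \<in> carrier G"
    using n by simp
  then obtain v m where *: "v \<in> V" "m \<in> N" "n \<otimes> a = v \<otimes> m"
    by (rule VN_decomp)
  have yb: "inv y \<otimes> b = a \<otimes> inv y" and yc: "y \<otimes> c = a \<otimes> y"
    using inv_y_shift(1) y_c by (simp_all add: conj_eq_iff)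
  have a_conj: "a \<rhd> x \<in> N" if "x \<in> carrier G" "x \<otimes> a = a \<otimes> m'" "m' \<in> N" for x m'
  proof -
    have "a \<rhd> x = a \<otimes> (x \<otimes> a)"
      using that by (simp add: conj_by_def V_inv m_assoc)
    also have "\<dots> = m'"
      using that by (simp add: m_assoc [symmetric] a_sq)
    finally show ?thesis
      using that by simp
  qed
  consider "v = \<one>" | "v = a" | "v = b" | "v = c"
    using *(1) by (auto simp: V_def)
  then show thesis
  proof cases
    case 1
    then have "n \<otimes> a \<in> N"
      using * by simp
    then have "a = \<one>"
      using n by (simp add: N_cancel_left V_inter_N V_def)
    then show thesis
      using a_neq_one by simp
  next
    case 2
    then show thesis
      using that(1) a_conj [of n m] * n by simp
  next
    case 3
    have "inv y \<otimes> n \<otimes> a = inv y \<otimes> b \<otimes> m"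
      using * n 3 by (simp add: m_assoc)
    also have "\<dots> = a \<otimes> (inv y \<otimes> m)"
      using * by (simp add: yb m_assoc)
    finally show thesis
      using that(2) a_conj [of "inv y \<otimes> n" "inv y \<otimes> m"] * n by simp
  next
    case 4
    have "y \<otimes> n \<otimes> a = y \<otimes> c \<otimes> m"
      using * n 4 by (simp add: m_assoc)
    also have "\<dots> = a \<otimes> (y \<otimes> m)"
      using * by (simp add: yc m_assoc)
    finally show thesis
      using that(3) a_conj [of "y \<otimes> n" "y \<otimes> m"] * n by simp
  qed
qed

lemma mem_V: "a \<in> V" "b \<in> V" "c \<in> V" "\<one> \<in> V"
  by (auto simp: V_def)

lemma a_conj_in_N_iff: "p \<in> P \<Longrightarrow> a \<rhd> p \<in> N \<longleftrightarrow> p \<in> D"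
  using mem_D_if_conj_in_N [of p a] a_neq_one mem_V by auto

text \<open>
  Otherwise \<open>P\<close> would contain the commutator of \<open>a\<close> and \<open>y\<close>, which is the involution \<open>c\<close>.
\<close>

lemma y_notin_D: "y \<notin> D" "inv y \<notin> D"
proof -
  show "y \<notin> D"
  proof
    assume "y \<in> D"
    then have "(a \<rhd> y) \<otimes> inv y \<in> P"
      by simp
    moreover have "(a \<rhd> y) \<otimes> inv y = a \<otimes> (y \<rhd> a)"
      by (simp add: conj_by_def V_inv m_assoc)
    ultimately have "c \<in> P"
      by (simp add: y_a V_products)
    then show False
      using V_inter_N [of c] V_neq mem_V by simp
  qed
  then show "inv y \<notin> D"
    by (metis D_inv P_closed inv_inv y_in_P)
qed

lemma P_cases:
  assumes "p \<in> P"
  obtains d where "d \<in> D" "p = d" | d where "d \<in> D" "p = y \<otimes> d" | d where "d \<in> D" "p = inv y \<otimes> d"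
proof -
  have "p \<in> N"
    using assms by simp
  then show thesis
  proof (cases rule: a_conj_in_N_cases)
    case 1
    then show thesis
      using assms that(1) by (simp add: a_conj_in_N_iff)
  next
    case 2
    then have "inv y \<otimes> p \<in> D"
      using assms by (simp add: a_conj_in_N_iff)
    then show thesis
      using that(2) [of "inv y \<otimes> p"] assms by simp
  next
    case 3
    then have "y \<otimes> p \<in> D"
      using assms by (simp add: a_conj_in_N_iff)
    then show thesis
      using that(3) [of "y \<otimes> p"] assms by simp
  qed
qed

lemma finite_P: "finite P"
  using card_P by (metis card.infinite zero_neq_numeral)

lemma finite_D: "finite D"
  using finite_subset [OF _ finite_P] D_in_P by blast

text \<open>
  The cosets of \<open>1\<close>, \<open>y\<close> and the inverse of \<open>y\<close> cover \<open>P\<close>, so the index of \<open>D\<close> in \<open>P\<close> is at most 3, and it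
  is not 1 because \<open>y\<close> lies outside \<open>D\<close>.
\<close>

lemma card_D: "card D = 3"
proof -
  interpret P: group "G\<lparr>carrier := P\<rparr>"
    using P_subgroup by (rule subgroup_imp_group)
  have "subgroup D (G\<lparr>carrier := P\<rparr>)"
    by (rule subgroup_incl [OF D_subgroup P_subgroup]) auto
  from P.card_subgroup_dvd [OF this] have "card D dvd 3 ^ 2"
    by (simp add: order_def card_P)
  then obtain i where i: "i \<le> 2" "card D = 3 ^ i"
    using prime_3 divides_primepow_nat by blast
  have "P \<subseteq> D \<union> (\<otimes>) y ` D \<union> (\<otimes>) (inv y) ` D"
    by (auto elim!: P_cases)
  then have "card P \<le> card (D \<union> (\<otimes>) y ` D \<union> (\<otimes>) (inv y) ` D)"
    using finite_D by (intro card_mono) auto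
  also have "\<dots> \<le> card D + card D + card D"
    using finite_D card_Un_le [of "D \<union> (\<otimes>) y ` D"] card_Un_le [of D]
      card_image_le [OF finite_D] by (meson add_mono le_trans le_refl)
  finally have "3 \<le> card D"
    using card_P by simp
  moreover have "card D < card P"
    using finite_P y_notin_D(1) y_in_P by (intro psubset_card_mono) auto
  ultimately show ?thesis
    using i card_P by (auto simp: le_Suc_eq numeral_2_eq_2)
qed

lemma D_eq: "d \<in> D \<Longrightarrow> d \<noteq> \<one> \<Longrightarrow> D = {\<one>, d, inv d}"
proof -
  assume d: "d \<in> D" "d \<noteq> \<one>"
  then have "d \<noteq> inv d" "inv d \<noteq> \<one>"
    using P_eq_inv [of d] by auto
  then have "card {\<one>, d, inv d} = 3"
    using d(2) by (simp add: eq_commute [of \<one>])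
  then show ?thesis
    using d by (intro card_subset_eq [symmetric] finite_D) (auto simp: card_D)
qed

lemma D_nontrivial: obtains e where "e \<in> D" "e \<noteq> \<one>"
proof -
  have "D \<noteq> {\<one>}"
    using card_D by auto
  then show thesis
    using that D_one by blast
qed

lemma D_sq: "d \<in> D \<Longrightarrow> d \<otimes> d = inv d"
proof (cases "d = \<one>")
  case False
  assume d: "d \<in> D"
  have "d \<otimes> d \<in> {\<one>, d, inv d}"
    using D_mult [OF d d] unfolding D_eq [OF d False] .
  moreover have "d \<otimes> d \<noteq> \<one>" "d \<otimes> d \<noteq> d"
    using d False P_no_involution [of d] by auto
  ultimately show ?thesis
    by simp
qed simp

lemma D_cube: "d \<in> D \<Longrightarrow> d \<otimes> d \<otimes> d = \<one>"
  by (simp add: D_sq)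

section \<open>The two signs of the normalizer\<close>

definition C where "C = {g \<in> carrier G. \<forall>d\<in>D. g \<rhd> d = d}"

lemma C_closed [simp]: "g \<in> C \<Longrightarrow> g \<in> carrier G"
  and C_conj_D [simp]: "g \<in> C \<Longrightarrow> d \<in> D \<Longrightarrow> g \<rhd> d = d"
  by (auto simp: C_def)

text \<open>
  Inversion is the only nontrivial automorphism of a group of order 3. The next lemmas turn this into
  a sign: membership in \<open>C\<close> behaves like parity under multiplication.
\<close>

lemma not_C_conj_D: "g \<in> carrier G \<Longrightarrow> g \<notin> C \<Longrightarrow> d \<in> D \<Longrightarrow> g \<rhd> d = inv d"
proof -
  assume g: "g \<in> carrier G" "g \<notin> C" and d: "d \<in> D"
  then obtain e where e: "e \<in> D" "g \<rhd> e \<noteq> e"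
    unfolding C_def by blast
  then have e1: "e \<noteq> \<one>"
    using g by auto
  have D: "D = {\<one>, e, inv e}"
    using e(1) e1 by (rule D_eq)
  have "g \<rhd> e \<in> D"
    using e g by simp
  moreover have "g \<rhd> e \<noteq> \<one>"
    using e(1) g e1 by simp
  ultimately have "g \<rhd> e = inv e"
    using e(2) D by auto
  then show "g \<rhd> d = inv d"
    using d e(1) g(1) D_in_P [OF e(1)] unfolding D by (auto simp: conj_inv)
qed

lemma C_iff: "g \<in> carrier G \<Longrightarrow> d \<in> D \<Longrightarrow> d \<noteq> \<one> \<Longrightarrow> g \<in> C \<longleftrightarrow> g \<rhd> d = d"
  by (metis C_conj_D D_in_P P_eq_inv not_C_conj_D)

lemma C_mult_iff: "g \<in> carrier G \<Longrightarrow> h \<in> carrier G \<Longrightarrow> g \<otimes> h \<in> C \<longleftrightarrow> (g \<in> C \<longleftrightarrow> h \<in> C)"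
proof -
  assume gh: "g \<in> carrier G" "h \<in> carrier G"
  obtain e where e: "e \<in> D" "e \<noteq> \<one>"
    by (rule D_nontrivial)
  have ne: "inv e \<noteq> e"
    using e P_eq_inv [of e] by auto
  have *: "(g \<otimes> h) \<rhd> e = g \<rhd> h \<rhd> e"
    using gh e(1) by (simp add: conj_conj)
  have e_closed: "e \<in> carrier G"
    using e(1) by simp
  have g: "g \<rhd> e = (if g \<in> C then e else inv e)" and h: "h \<rhd> e = (if h \<in> C then e else inv e)"
    using gh e(1) not_C_conj_D by auto
  have g': "g \<rhd> inv e = (if g \<in> C then inv e else e)"
    using gh(1) g e_closed by (auto simp: conj_inv)
  have "(g \<otimes> h) \<rhd> e = e \<longleftrightarrow> (g \<in> C \<longleftrightarrow> h \<in> C)"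
    unfolding * h using g g' ne by (cases "h \<in> C"; cases "g \<in> C") auto
  then show ?thesis
    using C_iff [OF m_closed [OF gh] e] by blast
qed

lemma P_in_C [simp]: "p \<in> P \<Longrightarrow> p \<in> C"
  unfolding C_def by simp

lemma C_inv_iff [simp]: "g \<in> carrier G \<Longrightarrow> inv g \<in> C \<longleftrightarrow> g \<in> C"
  using C_mult_iff [of g "inv g"] by simp

lemma C_conj_iff [simp]: "g \<in> carrier G \<Longrightarrow> h \<in> carrier G \<Longrightarrow> g \<rhd> h \<in> C \<longleftrightarrow> h \<in> C"
  by (auto simp: conj_by_def C_mult_iff)

text \<open>
  The involution \<open>c\<close> is a product of elements of order 3, each in a Sylow 3-subgroup; those are abelian
  and contain \<open>D\<close>. The other involutions of \<open>V\<close> are conjugates of \<open>c\<close>.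
\<close>

lemma V_in_C [simp]: "v \<in> V \<Longrightarrow> v \<in> C"
proof -
  have "c = (a \<rhd> y) \<otimes> inv y"
    by (simp add: conj_by_def V_inv m_assoc c_def b_def)
  then have c: "c \<in> C"
    by (simp add: C_mult_iff)
  have a: "a \<in> C"
    using c y_c by (metis C_conj_iff P_closed c_closed y_in_P)
  have "b \<in> C"
    using a by (simp add: b_def)
  then show "v \<in> V \<Longrightarrow> v \<in> C"
    using a c by (auto simp: V_def)
qed

lemma C_commute: "g \<in> C \<Longrightarrow> d \<in> D \<Longrightarrow> g \<otimes> d = d \<otimes> g"
  using C_conj_D [of g d] by (simp add: conj_eq_iff del: C_conj_D)

text \<open>
  The kernel of the sign by which \<open>N\<close> acts on the quotient of \<open>P\<close> by \<open>D\<close>, a group of order 3 generated by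
  the class of \<open>y\<close>.
\<close>

definition M where "M = {n \<in> N. \<exists>d\<in>D. n \<rhd> y = y \<otimes> d}"

lemma mem_M_iff: "n \<in> N \<Longrightarrow> n \<in> M \<longleftrightarrow> (\<exists>d\<in>D. n \<rhd> y = y \<otimes> d)"
  by (simp add: M_def)

lemma M_in_N [simp]: "m \<in> M \<Longrightarrow> m \<in> N"
  by (simp add: M_def)

lemma not_M_conj_y: "n \<in> N \<Longrightarrow> n \<notin> M \<Longrightarrow> \<exists>d\<in>D. n \<rhd> y = inv y \<otimes> d"
proof -
  assume n: "n \<in> N" "n \<notin> M"
  then have "n \<rhd> y \<in> P"
    by simp
  then show ?thesis
  proof (cases rule: P_cases)
    case (1 d)
    then have "inv n \<rhd> n \<rhd> y \<in> D"
      using n by simp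
    then show ?thesis
      using n y_notin_D by simp
  qed (use n in \<open>auto simp: mem_M_iff\<close>)
qed

lemma y_sq_notin_D: "y \<otimes> y \<notin> D"
proof
  assume "y \<otimes> y \<in> D"
  then have "inv (y \<otimes> y) \<in> D"
    by simp
  moreover have "inv (y \<otimes> y) = y"
    using y_cube by (intro inv_equality) (simp_all add: numeral_3_eq_3 m_assoc)
  ultimately show False
    using y_notin_D by simp
qed

lemma not_mem_M_if: "n \<in> N \<Longrightarrow> d \<in> D \<Longrightarrow> n \<rhd> y = inv y \<otimes> d \<Longrightarrow> n \<notin> M"
proof
  assume *: "n \<in> N" "d \<in> D" "n \<rhd> y = inv y \<otimes> d" "n \<in> M"
  then obtain d' where d': "d' \<in> D" "y \<otimes> d' = inv y \<otimes> d"
    using mem_M_iff [of n] by auto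
  then have "y \<otimes> (y \<otimes> d') = d"
    using * by simp
  then have "(y \<otimes> y) \<otimes> d' \<in> D"
    using d' * by (simp add: m_assoc)
  then show False
    using y_sq_notin_D d' by (simp add: D_cancel_right)
qed

lemma M_mult_iff: "n \<in> N \<Longrightarrow> m \<in> N \<Longrightarrow> n \<otimes> m \<in> M \<longleftrightarrow> (n \<in> M \<longleftrightarrow> m \<in> M)"
proof -
  assume nm: "n \<in> N" "m \<in> N"
  have M: "x \<in> M \<longleftrightarrow> (\<exists>d\<in>D. x \<rhd> y = y \<otimes> d)" if "x \<in> N" for x
    using that by (rule mem_M_iff)
  have sgn: "\<exists>d\<in>D. x \<rhd> y = (if x \<in> M then y else inv y) \<otimes> d" if "x \<in> N" for x
    using that not_M_conj_y [OF that] by (auto simp: mem_M_iff)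
  obtain d where d: "d \<in> D" "n \<rhd> y = (if n \<in> M then y else inv y) \<otimes> d"
    using sgn nm by blast
  obtain d' where d': "d' \<in> D" "m \<rhd> y = (if m \<in> M then y else inv y) \<otimes> d'"
    using sgn nm by blast
  have *: "(n \<otimes> m) \<rhd> y = n \<rhd> ((if m \<in> M then y else inv y) \<otimes> d')"
    using nm d' by (simp add: conj_conj)
  also have "\<dots> = (if m \<in> M then n \<rhd> y else inv (n \<rhd> y)) \<otimes> (n \<rhd> d')"
    using nm d' by (simp add: conj_mult conj_inv)
  finally have eq: "(n \<otimes> m) \<rhd> y = (if m \<in> M then n \<rhd> y else inv (n \<rhd> y)) \<otimes> (n \<rhd> d')" .
  have nd: "n \<rhd> d' \<in> D"
    using nm d' by simp
  show ?thesis
  proof (cases "n \<in> M \<longleftrightarrow> m \<in> M")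
    case True
    have "\<exists>d''\<in>D. (n \<otimes> m) \<rhd> y = y \<otimes> d''"
    proof (cases "m \<in> M")
      case mM: True
      then show ?thesis
        using True eq d nd by (auto simp: m_assoc intro!: bexI [of _ "d \<otimes> (n \<rhd> d')"])
    next
      case mM: False
      have "inv (inv y \<otimes> d) = y \<otimes> inv d"
        using d(1) P_commute [of "inv d" y] by (simp add: inv_mult_group)
      then show ?thesis
        using mM True eq d nd by (auto simp: m_assoc intro!: bexI [of _ "inv d \<otimes> (n \<rhd> d')"])
    qed
    then show ?thesis
      using True nm by (simp add: M)
  next
    case False
    have "\<exists>d''\<in>D. (n \<otimes> m) \<rhd> y = inv y \<otimes> d''"
    proof (cases "m \<in> M")
      case mM: True
      then show ?thesis
        using False eq d nd by (auto simp: m_assoc intro!: bexI [of _ "d \<otimes> (n \<rhd> d')"])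
    next
      case mM: False
      have "inv (y \<otimes> d) = inv y \<otimes> inv d"
        using d(1) P_commute [of "inv d" "inv y"] by (simp add: inv_mult_group)
      then show ?thesis
        using mM False eq d nd by (auto simp: m_assoc intro!: bexI [of _ "inv d \<otimes> (n \<rhd> d')"])
    qed
    then show ?thesis
      using False nm not_mem_M_if [of "n \<otimes> m"] by auto
  qed
qed

lemma P_in_M [simp]: "p \<in> P \<Longrightarrow> p \<in> M"
  by (auto simp: mem_M_iff intro!: bexI [of _ \<one>])

lemma M_inv_iff [simp]: "n \<in> N \<Longrightarrow> inv n \<in> M \<longleftrightarrow> n \<in> M"
  using M_mult_iff [of n "inv n"] by simp

section \<open>The kernel of the action on the Sylow 3-subgroups\<close>

text \<open>
  The kernel of the action of \<open>G\<close> on its Sylow 3-subgroups, described as the core of \<open>N\<close>.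
\<close>

definition K where "K = {g \<in> carrier G. \<forall>h\<in>carrier G. h \<rhd> g \<in> N}"

lemma K_conj [simp]: "g \<in> carrier G \<Longrightarrow> k \<in> K \<Longrightarrow> g \<rhd> k \<in> K"
  unfolding K_def by (simp add: conj_conj [symmetric])

lemma K_mult [simp]: "k \<in> K \<Longrightarrow> l \<in> K \<Longrightarrow> k \<otimes> l \<in> K"
  and K_inv [simp]: "k \<in> K \<Longrightarrow> inv k \<in> K"
  by (simp_all add: K_def conj_mult conj_inv)

lemma D_in_K [simp]: "d \<in> D \<Longrightarrow> d \<in> K"
  by (simp add: K_def)

lemma K_in_N [simp]: "k \<in> K \<Longrightarrow> k \<in> N"
  unfolding K_def by (metis (no_types, lifting) mem_Collect_eq one_closed one_conj)

lemma P_inter_K: "p \<in> P \<Longrightarrow> p \<in> K \<Longrightarrow> p \<in> D"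
  using a_conj_in_N_iff [of p] K_conj [of a p] K_in_N a_closed by blast

text \<open>
  If \<open>k\<close> inverted \<open>y\<close> modulo \<open>D\<close>, the commutator of \<open>k\<close> and \<open>y\<close> would be a power of \<open>y\<close> modulo \<open>D\<close> and would
  lie in the normal subgroup \<open>K\<close>, but \<open>P\<close> meets \<open>K\<close> only in \<open>D\<close>.
\<close>

lemma K_in_M [simp]: "k \<in> K \<Longrightarrow> k \<in> M"
proof (rule ccontr)
  assume k: "k \<in> K" "k \<notin> M"
  then obtain d where d: "d \<in> D" "k \<rhd> y = inv y \<otimes> d"
    using not_M_conj_y [of k] by auto
  have "k \<otimes> (y \<rhd> inv k) \<in> K"
    using k by simp
  moreover have "k \<otimes> (y \<rhd> inv k) = (k \<rhd> y) \<otimes> inv y"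
    using k by (simp add: conj_by_def m_assoc)
  moreover have "(k \<rhd> y) \<otimes> inv y \<in> P"
    using k by simp
  ultimately have "inv y \<otimes> d \<otimes> inv y \<in> D"
    using P_inter_K d by metis
  then have "inv (inv y \<otimes> d \<otimes> inv y) \<in> D"
    by simp
  moreover have "inv (inv y \<otimes> d \<otimes> inv y) = y \<otimes> y \<otimes> inv d"
    using d(1) P_commute [of "inv d" y] by (simp add: inv_mult_group m_assoc)
  ultimately show False
    using y_sq_notin_D d(1) by (simp add: D_cancel_right)
qed

text \<open>
  A permutation of the three Sylow 3-subgroups other than \<open>P\<close> that commutes with the 3-cycle \<open>y\<close> and has
  a fixed point is trivial.
\<close>

lemma mem_K_if_a_conj_in_N:
  assumes n: "n \<in> M" "a \<rhd> n \<in> N"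
  shows "n \<in> K"
proof -
  obtain d where d: "d \<in> D" "n \<rhd> y = y \<otimes> d"
    using n mem_M_iff [of n] by auto
  have "inv y \<rhd> n = inv y \<otimes> (n \<rhd> y) \<otimes> n"
    using n by (simp add: conj_by_def m_assoc)
  also have "\<dots> = d \<otimes> n"
    using n d by (simp add: m_assoc)
  finally have inv_y: "inv y \<rhd> n = d \<otimes> n" .
  have bn: "b \<rhd> n \<in> N"
    using n d by (simp add: b_conj inv_y conj_mult)
  have cn: "c \<rhd> n \<in> N"
    using n d bn by (simp add: c_conj inv_y conj_mult [of b])
  have V: "v \<rhd> n \<in> N" if "v \<in> V" for v
    using that n bn cn by (auto simp: V_def)
  have "h \<rhd> n \<in> N" if "h \<in> carrier G" for h
  proof -
    obtain m v where "v \<in> V" "m \<in> N" "h = m \<otimes> v"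
      using \<open>h \<in> carrier G\<close> by (rule NV_decomp)
    then show ?thesis
      using V n by (simp add: conj_conj)
  qed
  then show ?thesis
    unfolding K_def using N_closed [OF M_in_N [OF n(1)]] by blast
qed

text \<open>
  The permutations of three points that commute with a 3-cycle are its powers.
\<close>

lemma M_cases:
  assumes "n \<in> M"
  obtains k where "k \<in> K" "n = k" | k where "k \<in> K" "n = y \<otimes> k" | k where "k \<in> K" "n = inv y \<otimes> k"
proof -
  have n: "n \<in> N"
    using assms by simp
  then show thesis
  proof (cases rule: a_conj_in_N_cases)
    case 1
    then show thesis
      using assms that(1) mem_K_if_a_conj_in_N by blast
  next
    case 2
    then have "inv y \<otimes> n \<in> K"
      using assms by (intro mem_K_if_a_conj_in_N) (auto simp: M_mult_iff)
    then show thesis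
      using that(2) [of "inv y \<otimes> n"] n by simp
  next
    case 3
    then have "y \<otimes> n \<in> K"
      using assms by (intro mem_K_if_a_conj_in_N) (auto simp: M_mult_iff)
    then show thesis
      using that(3) [of "y \<otimes> n"] n by simp
  qed
qed

text \<open>
  Modulo \<open>K\<close> the element is a power of \<open>y\<close>, so its order there divides both 3 and 4.
\<close>

lemma mem_K_if_pow_4:
  assumes n: "n \<in> M" "n [^] (4::nat) = \<one>"
  shows "n \<in> K"
proof -
  (* Modulo the normal subgroup K the factor k disappears from the square. *)
  have sq: "\<exists>l\<in>K. (w \<otimes> k) \<otimes> (w \<otimes> k) = (w \<otimes> w) \<otimes> l" if "w \<in> carrier G" "k \<in> K" for w k
  proof (rule bexI)
    show "(w \<otimes> k) \<otimes> (w \<otimes> k) = (w \<otimes> w) \<otimes> ((inv w \<rhd> k) \<otimes> k)"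
      using that by (simp add: conj_by_def m_assoc)
  qed (use that in simp)
  have *: False if w: "w \<in> P" "w \<notin> D" "w \<otimes> w \<otimes> (w \<otimes> w) = w" "k \<in> K" "n = w \<otimes> k" for w k
  proof -
    obtain l where l: "l \<in> K" "(w \<otimes> k) \<otimes> (w \<otimes> k) = (w \<otimes> w) \<otimes> l"
      using sq w by (metis P_closed)
    obtain m where m: "m \<in> K" "((w \<otimes> w) \<otimes> l) \<otimes> ((w \<otimes> w) \<otimes> l) = ((w \<otimes> w) \<otimes> (w \<otimes> w)) \<otimes> m"
      using sq [of "w \<otimes> w"] l w by auto
    have "n [^] (4::nat) = (n \<otimes> n) \<otimes> (n \<otimes> n)"
      using n by (simp add: numeral_eq_Suc m_assoc)
    also have "\<dots> = w \<otimes> m"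
      using l m w by simp
    finally have "inv m = w"
      using n w m(1) by (metis inv_equality P_closed K_in_N N_closed)
    then have "w \<in> K"
      using m(1) by auto
    then show False
      using P_inter_K w by blast
  qed
  have y3: "y \<otimes> (y \<otimes> y) = \<one>"
    using y_cube by (simp add: numeral_3_eq_3 m_assoc)
  have y4: "y \<otimes> y \<otimes> (y \<otimes> y) = y"
    using y3 by (simp add: m_assoc)
  then have y4': "inv y \<otimes> inv y \<otimes> (inv y \<otimes> inv y) = inv y"
    by (metis P_closed inv_mult_group m_closed y_in_P)
  show ?thesis
    using n(1)
  proof (cases rule: M_cases)
    case (2 k)
    then show ?thesis
      using * [of y k] y4 y_notin_D by simp
  next
    case (3 k)
    then show ?thesis
      using * [of "inv y" k] y4' y_notin_D by simp
  qed simp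
qed

text \<open>
  By \<open>B_centralizes_P\<close> below, this is the centralizer of \<open>P\<close>.
\<close>

definition B where "B = M \<inter> C"

lemma P_in_B [simp]: "p \<in> P \<Longrightarrow> p \<in> B"
  by (simp add: B_def)

lemma B_mult [simp]: "g \<in> B \<Longrightarrow> h \<in> B \<Longrightarrow> g \<otimes> h \<in> B"
  and B_inv [simp]: "h \<in> B \<Longrightarrow> inv h \<in> B"
  by (auto simp: B_def M_mult_iff C_mult_iff)

lemma B_in [simp]: "h \<in> B \<Longrightarrow> h \<in> M" "h \<in> B \<Longrightarrow> h \<in> C"
  by (auto simp: B_def)

lemma B_subgroup: "subgroup B G"
proof (rule subgroupI)
  show "B \<noteq> {}"
    using P_in_B [OF P_one] by blast
qed auto

text \<open>
  The element \<open>h\<close> fixes \<open>D\<close> pointwise and moves \<open>y\<close> to \<open>yd\<close>, so its fourth power moves \<open>y\<close> to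
  \<open>yd\<^sup>4 = yd\<close>. That fourth power lies in the abelian group \<open>P\<close>, which makes \<open>d\<close> trivial.
\<close>

lemma B_centralizes_P: "h \<in> B \<Longrightarrow> p \<in> P \<Longrightarrow> h \<rhd> p = p"
proof -
  assume h: "h \<in> B" and p: "p \<in> P"
  obtain d where d: "d \<in> D" "h \<rhd> y = y \<otimes> d"
    using h B_in(1) [of h] mem_M_iff [of h] by auto
  have hd: "h \<rhd> d = d"
    using h d by simp
  have h_closed: "h \<in> carrier G"
    using h by simp
  have "(h \<otimes> h) \<rhd> y = y \<otimes> (d \<otimes> d)"
    using h_closed d by (simp add: conj_conj conj_mult hd m_assoc)
  moreover have "(h \<otimes> h) \<rhd> (d \<otimes> d) = d \<otimes> d"
    using h_closed d by (simp add: conj_conj conj_mult hd)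
  moreover have "(h \<otimes> h \<otimes> (h \<otimes> h)) \<rhd> y = (h \<otimes> h) \<rhd> (h \<otimes> h) \<rhd> y"
    using h_closed by (intro conj_conj) auto
  moreover have "(h \<otimes> h) \<rhd> (y \<otimes> (d \<otimes> d)) = ((h \<otimes> h) \<rhd> y) \<otimes> ((h \<otimes> h) \<rhd> (d \<otimes> d))"
    using h_closed d by (intro conj_mult) auto
  ultimately have "(h \<otimes> h \<otimes> (h \<otimes> h)) \<rhd> y = y \<otimes> (d \<otimes> d) \<otimes> (d \<otimes> d)"
    by (simp only:)
  also have "\<dots> = y \<otimes> (d \<otimes> d \<otimes> (d \<otimes> d))"
    using d by (simp add: m_assoc)
  finally have "(h \<otimes> h \<otimes> (h \<otimes> h)) \<rhd> y = y \<otimes> (d \<otimes> d \<otimes> (d \<otimes> d))" .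
  moreover have "h \<otimes> h \<otimes> (h \<otimes> h) = h [^] (4::nat)"
    using h_closed by (simp add: numeral_eq_Suc m_assoc)
  moreover have "h [^] (4::nat) \<in> P"
    using h by (simp add: N_pow_4)
  moreover have "d \<otimes> d \<otimes> (d \<otimes> d) = d"
    using d D_cube [of d] by (simp add: m_assoc)
  ultimately have "y = y \<otimes> d"
    by simp
  then have "d = \<one>"
    using d by simp
  then have hy: "h \<rhd> y = y"
    using d by simp
  from p show "h \<rhd> p = p"
    by (cases rule: P_cases) (use h hy h_closed in \<open>auto simp: conj_mult conj_inv\<close>)
qed

text \<open>
  The ninth power is the projection onto the 2-part: it kills the 3-part and stays in the coset of \<open>n\<close>.
\<close>

lemma pow_9_of_N:
  assumes "n \<in> N"
  shows "(n [^] (9::nat)) [^] (4::nat) = \<one>" "\<exists>p\<in>P. n [^] (9::nat) = p \<otimes> n"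
proof -
  have "(n [^] (9::nat)) [^] (4::nat) = (n [^] (4::nat)) [^] (9::nat)"
    using assms by (simp add: nat_pow_pow)
  then show "(n [^] (9::nat)) [^] (4::nat) = \<one>"
    using assms by (simp add: N_pow_4 P_pow_9)
  have "n [^] (9::nat) = (n [^] (4::nat)) [^] (2::nat) \<otimes> n"
    using assms by (simp add: numeral_eq_Suc m_assoc)
  then show "\<exists>p\<in>P. n [^] (9::nat) = p \<otimes> n"
    using N_pow_4 [OF assms] P_pow by blast
qed

end

section \<open>The case of a self-centralizing Sylow 3-subgroup\<close>

context order_144_with_A4
begin

text \<open>
  If \<open>K\<close> centralized \<open>D\<close>, then \<open>K\<close> and with it \<open>M\<close> would be contained in \<open>P\<close>. Since \<open>M\<close> has index at most
  2 in \<open>N\<close>, this contradicts the order of \<open>N\<close>.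
\<close>

lemma not_K_subset_C:
  assumes BP: "B \<subseteq> P"
  shows "\<not> K \<subseteq> C"
proof
  assume "K \<subseteq> C"
  then have "K \<subseteq> P"
    using BP K_in_M unfolding B_def by blast
  have MP: "M \<subseteq> P"
  proof
    fix n assume "n \<in> M"
    then show "n \<in> P"
      by (cases rule: M_cases) (use \<open>K \<subseteq> P\<close> in auto)
  qed
  have finM: "finite M"
    using MP finite_P finite_subset by blast
  have "\<exists>n. N \<subseteq> M \<union> (\<otimes>) n ` M"
  proof (cases "N \<subseteq> M")
    case False
    then obtain n where n: "n \<in> N" "n \<notin> M"
      by blast
    have "m \<in> (\<otimes>) n ` M" if "m \<in> N" "m \<notin> M" for m
    proof (rule image_eqI)
      show "m = n \<otimes> (inv n \<otimes> m)"
        using n that by simp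
      show "inv n \<otimes> m \<in> M"
        using n that by (simp add: M_mult_iff)
    qed
    then show ?thesis
      by blast
  qed auto
  then obtain n where "N \<subseteq> M \<union> (\<otimes>) n ` M"
    by blast
  then have "card N \<le> card (M \<union> (\<otimes>) n ` M)"
    using finM by (intro card_mono) auto
  also have "\<dots> \<le> card M + card M"
    using card_Un_le [of M "(\<otimes>) n ` M"] card_image_le [OF finM, of "(\<otimes>) n"] by linarith
  also have "\<dots> \<le> 18"
    using card_mono [OF finite_P MP] card_P by simp
  finally show False
    using card_N by simp
qed

text \<open>
  The set \<open>K - D\<close> is a coset of \<open>D\<close> and has three elements, each of which inverts \<open>D\<close>. An element that
  fixes all Sylow 3-subgroups lies in \<open>K\<close>; if it also commutes with \<open>K - D\<close>, it is a central element of
  \<open>K\<close>, hence trivial.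
\<close>

lemma iso_if_self_centralizing:
  assumes BP: "B \<subseteq> P"
  shows "G \<cong> sym_group 3 \<times>\<times> sym_group 4"
proof -
  obtain k where k: "k \<in> K" "k \<notin> C"
    using not_K_subset_C [OF BP] by blast
  have KC: "g \<in> D" if "g \<in> K" "g \<in> C" for g
  proof -
    have "g \<in> B"
      using that unfolding B_def by simp
    then show ?thesis
      using BP P_inter_K that(1) by blast
  qed
  let ?F = "K - D"
  have F: "?F = (\<otimes>) k ` D"
  proof (intro equalityI subsetI)
    fix g assume g: "g \<in> ?F"
    then have "g \<notin> C"
      using KC by blast
    then have "inv k \<otimes> g \<in> D"
      using g k by (intro KC) (auto simp: C_mult_iff)
    then show "g \<in> (\<otimes>) k ` D"
      using g k by (intro image_eqI [of _ _ "inv k \<otimes> g"]) auto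
  next
    fix g assume "g \<in> (\<otimes>) k ` D"
    then obtain d where d: "d \<in> D" "g = k \<otimes> d"
      by blast
    then have "g \<notin> C"
      using k by (simp add: C_mult_iff)
    then have "g \<notin> D"
      by auto
    then show "g \<in> ?F"
      using d k by simp
  qed
  have "inj_on ((\<otimes>) k) D"
    using k by (auto simp: inj_on_def)
  then have cardF: "card ?F = 3"
    unfolding F by (simp add: card_image card_D)
  have finF: "finite ?F"
    unfolding F using finite_D by simp
  have actF: "group_action G ?F (\<lambda>g. restrict ((\<rhd>) g) ?F)"
  proof (rule group_actionI)
    fix g x assume g: "g \<in> carrier G" and x: "x \<in> ?F"
    have "g \<rhd> x \<notin> D"
    proof
      assume "g \<rhd> x \<in> D"
      then have "inv g \<rhd> g \<rhd> x \<in> D"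
        using g by simp
      then show False
        using g x by simp
    qed
    then show "g \<rhd> x \<in> ?F"
      using g x by simp
  qed (auto simp: conj_conj)
  have cardL: "card (lcosets N) = 4"
    using l_lagrange [OF finite_G N_subgroup] card_N order_G by simp
  show ?thesis
  proof (rule iso_sym_group_product [OF actF finF cardF lcoset_action [OF N_subgroup] _ cardL])
    show "finite (lcosets N)"
      using cardL by (metis card.infinite zero_neq_numeral)
    show "order G = fact 3 * fact 4"
      by (simp add: order_G fact_numeral)
    fix g assume g: "g \<in> carrier G"
      and fix_F: "\<forall>x\<in>?F. restrict ((\<rhd>) g) ?F x = x"
      and fix_N: "\<forall>C\<in>lcosets N. (\<lambda>C\<in>lcosets N. g <# C) C = C"
    have "inv x \<rhd> g \<in> N" if "x \<in> carrier G" for x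
    proof -
      have "x <# N \<in> lcosets N"
        using that by (auto simp: LCOSETS_def)
      then have "g <# (x <# N) = x <# N"
        using fix_N by fastforce
      then show ?thesis
        using lcoset_translate_eq_iff [OF N_subgroup g that] by blast
    qed
    then have "x \<rhd> g \<in> N" if "x \<in> carrier G" for x
      using that by (metis inv_closed inv_inv)
    then have gK: "g \<in> K"
      using g unfolding K_def by blast
    have conj_F: "g \<rhd> (k \<otimes> d) = k \<otimes> d" if "d \<in> D" for d
      using fix_F that unfolding F by auto
    have gk: "g \<rhd> k = k"
      using conj_F [of \<one>] k by simp
    show "g = \<one>"
    proof (cases "g \<in> C")
      case True
      then have gD: "g \<in> D"
        using gK KC by blast
      then have "k \<rhd> g = inv g"
        using k by (intro not_C_conj_D) auto
      moreover have "k \<rhd> g = g"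
        using gk g k conj_fixed_sym by auto
      ultimately show ?thesis
        using P_eq_inv [of g] gD by simp
    next
      case False
      obtain e where e: "e \<in> D" "e \<noteq> \<one>"
        by (rule D_nontrivial)
      have "g \<rhd> (k \<otimes> e) = k \<otimes> inv e"
        using False g k e by (simp add: conj_mult gk not_C_conj_D)
      then have "inv e = e"
        using conj_F [OF e(1)] k e by simp
      then show ?thesis
        using P_eq_inv [of e] e by simp
    qed
  qed
qed

end

section \<open>The case of a central involution\<close>

text \<open>
  The centralizer of \<open>P\<close> is now larger than \<open>P\<close>. It will turn out that no such group contains all
  groups of order 12.
\<close>

locale order_144_with_A4_and_involution = order_144_with_A4 +
  assumes not_B_subset_P: "\<not> B \<subseteq> P"
begin

text \<open>
  The index of \<open>P\<close> in \<open>B\<close> divides 4; it is not 1 by assumption and not 4 because some element of \<open>N\<close>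
  inverts a nontrivial element of \<open>P\<close>.
\<close>

lemma card_B: "card B = 18"
proof -
  interpret B: group "G\<lparr>carrier := B\<rparr>"
    using B_subgroup by (rule subgroup_imp_group)
  interpret N: group "G\<lparr>carrier := N\<rparr>"
    using N_subgroup by (rule subgroup_imp_group)
  have "P \<subseteq> B"
    by auto
  then have "9 dvd card B"
    using B.card_subgroup_dvd [OF subgroup_incl [OF P_subgroup B_subgroup]] card_P by (simp add: order_def)
  then obtain j where j: "card B = 9 * j" ..
  have "B \<subseteq> N"
    by auto
  then have "card B dvd card N"
    using N.card_subgroup_dvd [OF subgroup_incl [OF B_subgroup N_subgroup]] by (simp add: order_def)
  then have "9 * j dvd 9 * 4"
    using j card_N by simp
  then have "j dvd 4"
    by (simp only: nat_mult_dvd_cancel_disj) simp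
  then have "j \<le> 4"
    by (rule dvd_imp_le) simp
  moreover have "j \<noteq> 3"
    using \<open>j dvd 4\<close> by (intro notI) simp
  moreover have "j \<noteq> 0"
    using \<open>j dvd 4\<close> by (intro notI) simp
  moreover have "j \<noteq> 1"
  proof
    assume "j = 1"
    then have "P = B"
      using j card_P by (intro card_subset_eq card_ge_0_finite) auto
    then show False
      using not_B_subset_P by simp
  qed
  moreover have "j \<noteq> 4"
  proof
    assume "j = 4"
    then have "B = N"
      using j card_N by (intro card_subset_eq card_ge_0_finite) auto
    moreover obtain n x where "n \<in> N" "x \<in> P" "x \<noteq> \<one>" "n \<rhd> x = inv x"
      using inverted by (auto simp: N_def)
    ultimately show False
      using B_centralizes_P [of n x] P_eq_inv [of x] by simp
  qed
  ultimately have "j = 2"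
    by linarith
  then show ?thesis
    using j by simp
qed

lemma finite_B: "finite B"
  using card_B by (intro card_ge_0_finite) simp

lemma involution_in_B:
  obtains z where "z \<in> B" "z \<notin> P" "z \<otimes> z = \<one>" "\<And>h. h \<in> B \<Longrightarrow> h \<in> P \<or> (\<exists>p\<in>P. h = z \<otimes> p)"
proof -
  have coset: "\<exists>p\<in>P. h = g \<otimes> p" if g: "g \<in> B" "g \<notin> P" and h: "h \<in> B" "h \<notin> P" for g h
  proof -
    have "inj_on ((\<otimes>) g) P"
      using g by (auto simp: inj_on_def)
    then have "card ((\<otimes>) g ` P) = 9"
      by (simp add: card_image card_P)
    moreover have disj: "P \<inter> (\<otimes>) g ` P = {}"
    proof -
      have "g \<otimes> p \<notin> P" if "p \<in> P" for p
      proof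
        assume "g \<otimes> p \<in> P"
        then have "g \<otimes> p \<otimes> inv p \<in> P"
          using that by simp
        then show False
          using g that by (simp add: m_assoc)
      qed
      then show ?thesis
        by blast
    qed
    ultimately have "card (P \<union> (\<otimes>) g ` P) = 18"
      using finite_P card_P by (simp add: card_Un_disjoint)
    then have "P \<union> (\<otimes>) g ` P = B"
      using g by (intro card_subset_eq finite_B) (auto simp: card_B)
    then show ?thesis
      using h by blast
  qed
  obtain g where g: "g \<in> B" "g \<notin> P"
    using not_B_subset_P by blast
  have g2: "g \<otimes> g \<in> P"
  proof (rule ccontr)
    assume "g \<otimes> g \<notin> P"
    then obtain p where "p \<in> P" "g \<otimes> g = g \<otimes> p"
      using coset [OF g, of "g \<otimes> g"] g by auto
    then show False
      using g by simp
  qed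
  (* The ninth power keeps the coset of g but has 2-power order. *)
  define z where "z = g [^] (9::nat)"
  obtain p where p: "p \<in> P" "z = p \<otimes> g"
    using pow_9_of_N(2) [of g] g by (auto simp: z_def)
  have "inv p \<otimes> z = g"
    using p g by simp
  then have "z \<notin> P"
    using p(1) g(2) by (metis P_inv P_mult)
  moreover have "z \<in> B"
    using p g by simp
  moreover have "z \<otimes> z = (g \<otimes> g) [^] (9::nat)"
    using g by (simp add: z_def pow_mult_distrib)
  then have "z \<otimes> z = \<one>"
    using g2 by (simp add: P_pow_9)
  ultimately show thesis
    using that coset by blast
qed

definition z where "z = (SOME z. z \<in> B \<and> z \<notin> P \<and> z \<otimes> z = \<one> \<and> (\<forall>h\<in>B. h \<in> P \<or> (\<exists>p\<in>P. h = z \<otimes> p)))"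

lemma z_facts: "z \<in> B" "z \<notin> P" "z \<otimes> z = \<one>" "h \<in> B \<Longrightarrow> h \<in> P \<or> (\<exists>p\<in>P. h = z \<otimes> p)"
proof -
  have "\<exists>z. z \<in> B \<and> z \<notin> P \<and> z \<otimes> z = \<one> \<and> (\<forall>h\<in>B. h \<in> P \<or> (\<exists>p\<in>P. h = z \<otimes> p))"
    using involution_in_B by metis
  from someI_ex [OF this] show "z \<in> B" "z \<notin> P" "z \<otimes> z = \<one>" "h \<in> B \<Longrightarrow> h \<in> P \<or> (\<exists>p\<in>P. h = z \<otimes> p)"
    by (auto simp: z_def [symmetric])
qed

lemma z_closed [simp]: "z \<in> carrier G"
  using z_facts(1) by simp

lemma inv_z [simp]: "inv z = z"
  by (rule inv_equality) (simp_all add: z_facts(3))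

lemma z_commutes_P: "p \<in> P \<Longrightarrow> z \<otimes> p = p \<otimes> z"
  using B_centralizes_P [OF z_facts(1), of p] by (simp add: conj_eq_iff)

lemma B_cases:
  assumes "h \<in> B"
  obtains p \<zeta> where "p \<in> P" "\<zeta> \<in> {\<one>, z}" "h = \<zeta> \<otimes> p"
proof -
  have "h \<in> P \<or> (\<exists>p\<in>P. h = z \<otimes> p)"
    using assms by (rule z_facts(4))
  then show thesis
    using that [of h \<one>] that [of _ z] by auto
qed

lemma B_involution:
  assumes "h \<in> B" "h \<otimes> h = \<one>"
  shows "h \<in> {\<one>, z}"
proof -
  obtain p \<zeta> where h: "p \<in> P" "\<zeta> \<in> {\<one>, z}" "h = \<zeta> \<otimes> p"
    using assms(1) by (rule B_cases)
  have "h \<otimes> h = p \<otimes> p"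
  proof (cases "\<zeta> = z")
    case True
    have "h \<otimes> h = z \<otimes> (p \<otimes> z) \<otimes> p"
      using h(1,3) True by (simp add: m_assoc)
    also have "\<dots> = z \<otimes> z \<otimes> (p \<otimes> p)"
      using h(1) by (simp add: z_commutes_P [symmetric] m_assoc)
    finally show ?thesis
      using h(1) by (simp add: z_facts(3))
  qed (use h in auto)
  then have "p = \<one>"
    using assms(2) h(1) P_no_involution by metis
  then show ?thesis
    using h by auto
qed

lemma z_in_K: "z \<in> K"
proof (rule mem_K_if_pow_4)
  show "z \<in> M"
    using z_facts(1) by simp
  have "z [^] (4::nat) = (z \<otimes> z) \<otimes> (z \<otimes> z)"
    by (simp add: numeral_eq_Suc m_assoc)
  then show "z [^] (4::nat) = \<one>"
    by (simp add: z_facts(3))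
qed

text \<open>
  The conjugates of \<open>z\<close> lie in the normal subgroups \<open>K\<close> and \<open>C\<close>, hence in \<open>B\<close>, where \<open>z\<close> is the only
  involution.
\<close>

lemma z_central [simp]: "g \<in> carrier G \<Longrightarrow> g \<rhd> z = z"
proof -
  assume g: "g \<in> carrier G"
  have "g \<rhd> z \<in> K" "g \<rhd> z \<in> C"
    using g z_facts(1) z_in_K by simp_all
  then have "g \<rhd> z \<in> B"
    unfolding B_def by simp
  moreover have "(g \<rhd> z) \<otimes> (g \<rhd> z) = \<one>"
    using g by (simp add: conj_mult [symmetric] z_facts(3))
  ultimately have "g \<rhd> z \<in> {\<one>, z}"
    by (rule B_involution)
  moreover have "g \<rhd> z \<noteq> \<one>"
    using g z_facts(2) by auto
  ultimately show ?thesis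
    by simp
qed

lemma z_commute: "g \<in> carrier G \<Longrightarrow> g \<otimes> z = z \<otimes> g"
  using z_central [of g] by (simp add: conj_eq_iff del: z_central)

lemma central_one_or_z:
  assumes "\<zeta> \<in> {\<one>, z}"
  shows "\<zeta> \<in> carrier G" "\<zeta> \<otimes> \<zeta> = \<one>" "\<And>g. g \<in> carrier G \<Longrightarrow> g \<rhd> \<zeta> = \<zeta>"
    "\<And>g. g \<in> carrier G \<Longrightarrow> g \<otimes> \<zeta> = \<zeta> \<otimes> g" "\<zeta> \<in> C" "\<zeta> \<in> K"
proof -
  have cases: "\<zeta> = \<one> \<or> \<zeta> = z"
    using assms by blast
  then show "\<zeta> \<in> carrier G" "\<zeta> \<otimes> \<zeta> = \<one>" "\<And>g. g \<in> carrier G \<Longrightarrow> g \<rhd> \<zeta> = \<zeta>"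
    "\<zeta> \<in> C" "\<zeta> \<in> K"
    using z_facts(3) B_in(2) [OF z_facts(1)] z_in_K D_in_K [OF D_one] by (elim disjE; simp)+
  from cases show "\<And>g. g \<in> carrier G \<Longrightarrow> g \<otimes> \<zeta> = \<zeta> \<otimes> g"
    by (elim disjE; simp only: z_commute l_one r_one)
qed

lemma N_outside_B:
  assumes n: "n \<in> N" "n \<notin> B" and m: "m \<in> N" "m \<notin> B"
  shows "inv n \<otimes> m \<in> B"
proof -
  have disj: "B \<inter> (\<otimes>) n ` B = {}"
  proof -
    have "n \<otimes> h \<notin> B" if "h \<in> B" for h
    proof
      assume "n \<otimes> h \<in> B"
      then have "n \<otimes> h \<otimes> inv h \<in> B"
        using that by simp
      then show False
        using n that by (simp add: m_assoc)
    qed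
    then show ?thesis
      by blast
  qed
  have "inj_on ((\<otimes>) n) B"
    using n by (auto simp: inj_on_def)
  then have "card (B \<union> (\<otimes>) n ` B) = 36"
    using disj finite_B by (simp add: card_Un_disjoint card_image card_B)
  then have "B \<union> (\<otimes>) n ` B = N"
    using n card_N by (intro card_subset_eq card_ge_0_finite) auto
  then obtain h where "h \<in> B" "m = n \<otimes> h"
    using m by blast
  then show ?thesis
    using n by simp
qed

text \<open>
  The elements \<open>m\<close> and \<open>n\<close> differ by an element \<open>\<zeta>p\<close> of \<open>B\<close>, with \<open>p\<close> in \<open>P\<close> and \<open>\<zeta>\<close> central of order at
  most 2. So their squares differ by an element of \<open>P\<close>. Both squares are \<open>1\<close> or \<open>z\<close>, and \<open>z\<close> is not in
  \<open>P\<close>.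
\<close>

lemma squares_agree:
  assumes n: "n \<in> N" "n \<notin> B" "n [^] (4::nat) = \<one>" and m: "m \<in> N" "m \<notin> B" "m [^] (4::nat) = \<one>"
  shows "m \<otimes> m = n \<otimes> n"
proof -
  have sq: "x \<otimes> x \<in> {\<one>, z}" if x: "x \<in> N" "x \<notin> B" "x [^] (4::nat) = \<one>" for x
  proof (rule B_involution)
    have "inv x \<notin> B"
      using x by (metis B_inv N_closed inv_inv)
    then show "x \<otimes> x \<in> B"
      using N_outside_B [of "inv x" x] x by simp
    show "x \<otimes> x \<otimes> (x \<otimes> x) = \<one>"
      using x by (simp add: numeral_eq_Suc m_assoc)
  qed
  define h where "h = inv n \<otimes> m"
  have "h \<in> B"
    using N_outside_B n m by (simp add: h_def)
  then obtain p \<zeta> where h: "p \<in> P" "\<zeta> \<in> {\<one>, z}" "h = \<zeta> \<otimes> p"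
    by (rule B_cases)
  note \<zeta> = central_one_or_z [OF h(2)]
  have m_eq: "m = n \<otimes> h"
    using n m by (simp add: h_def)
  define q where "q = (inv n \<rhd> p) \<otimes> p"
  have q: "q \<in> P"
    using n h by (simp add: q_def)
  have "m \<otimes> m = n \<otimes> n \<otimes> ((inv n \<rhd> h) \<otimes> h)"
    using n \<open>h \<in> B\<close> unfolding m_eq by (simp add: conj_by_def m_assoc)
  also have "(inv n \<rhd> h) \<otimes> h = \<zeta> \<otimes> (inv n \<rhd> p) \<otimes> (\<zeta> \<otimes> p)"
    using n(1) h(1,3) \<zeta>(1,3) by (simp add: conj_mult)
  also have "\<dots> = \<zeta> \<otimes> ((inv n \<rhd> p) \<otimes> \<zeta>) \<otimes> p"
    using n h(1) \<zeta>(1) by (simp add: m_assoc)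
  also have "\<dots> = \<zeta> \<otimes> (\<zeta> \<otimes> (inv n \<rhd> p)) \<otimes> p"
    using n h(1) \<zeta>(1) by (subst \<zeta>(4)) auto
  also have "\<dots> = \<zeta> \<otimes> \<zeta> \<otimes> q"
    using n h(1) \<zeta>(1) by (simp add: q_def m_assoc)
  also have "\<dots> = q"
    using q by (simp add: \<zeta>(2))
  finally have mq: "m \<otimes> m = n \<otimes> n \<otimes> q" .
  have nn: "n \<otimes> n \<in> {\<one>, z}" and mm: "m \<otimes> m \<in> {\<one>, z}"
    using sq n m by blast+
  have "q = inv (n \<otimes> n) \<otimes> (m \<otimes> m)"
    using mq n(1) q by simp
  then have "q \<in> {\<one>, z}"
    using nn mm by (auto simp: z_facts(3))
  then have "q = \<one>"
    using q z_facts(2) by auto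
  then show ?thesis
    using mq n(1) by simp
qed

text \<open>
  If \<open>D\<close> is central, an inverted element of \<open>P\<close> lies outside \<open>D\<close> and whatever inverts it lies in \<open>N\<close>. So
  \<open>w\<close> and \<open>t\<close> are subject to \<open>squares_agree\<close>.
\<close>

lemma central_D_contradiction:
  assumes C: "C = carrier G"
    and s: "s \<in> P" "s \<noteq> \<one>" and w: "w \<in> carrier G" "w [^] (2::nat) \<noteq> \<one>" "w [^] (4::nat) = \<one>" "w \<rhd> s = inv s"
    and r: "r \<in> P" "r \<noteq> \<one>" and t: "t \<in> carrier G" "t [^] (2::nat) = \<one>" "t \<rhd> r = inv r"
  shows False
proof -
  have *: "g \<in> N \<and> g \<notin> B" if "x \<in> P" "x \<noteq> \<one>" "g \<in> carrier G" "g \<rhd> x = inv x" for g x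
  proof
    have ne: "inv x \<noteq> x"
      using P_eq_inv [of x] that by auto
    then have "x \<notin> D"
      using that C_conj_D [of g x] C by auto
    then show "g \<in> N"
      using that by (intro fusion_outside_D [of x]) auto
    show "g \<notin> B"
      using B_centralizes_P [of g x] that ne by auto
  qed
  have "t [^] (4::nat) = t [^] (2::nat) \<otimes> t [^] (2::nat)"
    using t(1) by (simp add: numeral_eq_Suc m_assoc)
  then have "t [^] (4::nat) = \<one>"
    using t by simp
  then have "w \<otimes> w = t \<otimes> t"
    using squares_agree * s w r t by blast
  then show False
    using w t by (simp add: numeral_2_eq_2)
qed

lemma C_inter_N_in_B:
  assumes ex: "C \<noteq> carrier G" and n: "n \<in> N" "n \<in> C"
  shows "n \<in> B"
proof (rule ccontr)
  assume nB: "n \<notin> B"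
  obtain g where g: "g \<in> carrier G" "g \<notin> C"
    using ex by (metis C_closed subsetI subset_antisym)
  obtain v m where m: "v \<in> V" "m \<in> N" "g = v \<otimes> m"
    using g(1) by (rule VN_decomp)
  then have mC: "m \<notin> C"
    using g by (simp add: C_mult_iff)
  then have "m \<notin> B"
    by auto
  then have "inv n \<otimes> m \<in> C"
    using N_outside_B [OF n(1) nB m(2)] by simp
  then show False
    using n m mC by (simp add: C_mult_iff)
qed

text \<open>
  The alternating group of degree 4 has no elements of order 4 or 6: the products \<open>vy\<close> have order 3
  because the three conjugates of \<open>v\<close> by powers of \<open>y\<close> multiply to the identity.
\<close>

lemma A4_element_order:
  assumes "v \<in> V" "w \<in> {\<one>, y, inv y}"
  shows "(v \<otimes> w) \<otimes> (v \<otimes> w) = \<one> \<or> (v \<otimes> w) \<otimes> (v \<otimes> w) \<otimes> (v \<otimes> w) = \<one>"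
proof (cases "w = \<one>")
  case True
  then show ?thesis
    using assms V_sq by simp
next
  case False
  (* Collecting all factors w on the right, the cube of vw is the product of three conjugates of v
     times the cube of w. *)
  have w: "w \<in> P" and wV: "w \<rhd> v \<in> V" "w \<rhd> w \<rhd> v \<in> V" and
    prod: "v \<otimes> (w \<rhd> v) \<otimes> (w \<rhd> w \<rhd> v) = \<one>" and w3: "w \<otimes> w \<otimes> w = \<one>"
  proof -
    have y3: "y \<otimes> y \<otimes> y = \<one>"
      using y_cube by (simp add: numeral_3_eq_3)
    then have "inv y \<otimes> inv y \<otimes> inv y = \<one>"
      by (metis P_closed inv_mult_group inv_one m_assoc m_closed y_in_P)
    then show "w \<otimes> w \<otimes> w = \<one>"
      using assms(2) False y3 by auto
    show "w \<in> P" "w \<rhd> v \<in> V" "w \<rhd> w \<rhd> v \<in> V"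
      "v \<otimes> (w \<rhd> v) \<otimes> (w \<rhd> w \<rhd> v) = \<one>"
      using assms False mem_V
      by (auto simp: V_def y_a y_b y_c inv_y_shift V_products a_sq b_sq c_sq)
  qed
  have v: "v \<in> carrier G" and w_closed: "w \<in> carrier G"
    using assms w by simp_all
  have "v \<otimes> (w \<rhd> v) \<otimes> (w \<rhd> w \<rhd> v) \<otimes> (w \<otimes> w \<otimes> w) = (v \<otimes> w) \<otimes> (v \<otimes> w) \<otimes> (v \<otimes> w)"
    using v w_closed by (simp add: conj_by_def m_assoc)
  then show ?thesis
    using prod w3 by simp
qed

text \<open>
  This exhibits \<open>C\<close> as the product of three commuting factors: the alternating group, \<open>D\<close>, and the
  group generated by \<open>z\<close>.
\<close>

lemma C_normal_form:
  assumes ex: "C \<noteq> carrier G" and g: "g \<in> C"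
  obtains v w d \<zeta> where "v \<in> V" "w \<in> {\<one>, y, inv y}" "d \<in> D" "\<zeta> \<in> {\<one>, z}" "g = v \<otimes> w \<otimes> d \<otimes> \<zeta>"
proof -
  obtain v n where n: "v \<in> V" "n \<in> N" "g = v \<otimes> n"
    using C_closed [OF g] by (rule VN_decomp)
  then have "n \<in> C"
    using g by (simp add: C_mult_iff)
  then have "n \<in> B"
    using ex n C_inter_N_in_B by blast
  then obtain p \<zeta> where p: "p \<in> P" "\<zeta> \<in> {\<one>, z}" "n = \<zeta> \<otimes> p"
    by (rule B_cases)
  note \<zeta> = central_one_or_z [OF p(2)]
  from p(1) obtain w d where wd: "w \<in> {\<one>, y, inv y}" "d \<in> D" "p = w \<otimes> d"
  proof (cases rule: P_cases)
    case (1 d)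
    then show thesis
      using that [of \<one> d] by simp
  qed auto
  then have w: "w \<in> carrier G"
    by auto
  have "n = p \<otimes> \<zeta>"
    using p(1,3) \<zeta>(4) [of p] by simp
  then have "g = v \<otimes> w \<otimes> d \<otimes> \<zeta>"
    using n(1,3) wd(2,3) w \<zeta>(1) by (simp add: m_assoc)
  then show thesis
    using that n(1) wd p(2) by blast
qed

text \<open>
  The square of \<open>g = qd\<zeta>\<close> is \<open>q\<^sup>2d\<^sup>2\<close>. When \<open>q\<close> has order at most 2, the fourth power of \<open>g\<close> is \<open>d\<close>; when \<open>q\<close>
  has order 3, it is \<open>qd\<close>. If that power is trivial, then \<open>g\<^sup>2 = q\<^sup>2 = 1\<close> in the first case and \<open>g = \<zeta>\<close> in the
  second.
\<close>

lemma C_no_order_4: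
  assumes ex: "C \<noteq> carrier G" and g: "g \<in> C" "g [^] (4::nat) = \<one>"
  shows "g \<otimes> g = \<one>"
proof -
  obtain v w d \<zeta> where *: "v \<in> V" "w \<in> {\<one>, y, inv y}" "d \<in> D" "\<zeta> \<in> {\<one>, z}" "g = v \<otimes> w \<otimes> d \<otimes> \<zeta>"
    using ex g(1) by (rule C_normal_form)
  note \<zeta> = central_one_or_z [OF *(4)]
  define q where "q = v \<otimes> w"
  have w: "w \<in> P"
    using *(2) by auto
  have q: "q \<in> C" "q \<in> carrier G"
    using *(1) w by (simp_all add: q_def C_mult_iff)
  have d: "d \<in> carrier G"
    using *(3) by simp
  have qd: "q \<otimes> d \<in> carrier G"
    using q d by simp
  have g_eq: "g = (q \<otimes> d) \<otimes> \<zeta>"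
    using * w by (simp add: q_def)
  have "g \<otimes> g = (q \<otimes> d) \<otimes> (\<zeta> \<otimes> (q \<otimes> d)) \<otimes> \<zeta>"
    unfolding g_eq using qd \<zeta>(1) by (simp add: m_assoc)
  also have "\<dots> = (q \<otimes> d) \<otimes> (q \<otimes> d) \<otimes> (\<zeta> \<otimes> \<zeta>)"
    unfolding \<zeta>(4) [OF qd, symmetric] using qd \<zeta>(1) by (simp only: m_assoc m_closed)
  also have "\<dots> = (q \<otimes> d) \<otimes> (q \<otimes> d)"
    using qd by (simp add: \<zeta>(2))
  also have "\<dots> = q \<otimes> (d \<otimes> q) \<otimes> d"
    using q(2) d by (simp add: m_assoc)
  also have "\<dots> = q \<otimes> q \<otimes> (d \<otimes> d)"
    using q(2) d unfolding C_commute [OF q(1) *(3), symmetric] by (simp add: m_assoc)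
  finally have gg: "g \<otimes> g = q \<otimes> q \<otimes> (d \<otimes> d)" .
  have qq: "q \<otimes> q \<in> C"
    using q by (simp add: C_mult_iff)
  have "g [^] (4::nat) = (g \<otimes> g) \<otimes> (g \<otimes> g)"
    using g(1) by (simp add: numeral_eq_Suc m_assoc)
  also have "\<dots> = (q \<otimes> q) \<otimes> ((d \<otimes> d) \<otimes> (q \<otimes> q)) \<otimes> (d \<otimes> d)"
    unfolding gg using q(2) d by (simp add: m_assoc)
  also have "\<dots> = (q \<otimes> q) \<otimes> (q \<otimes> q) \<otimes> (d \<otimes> d \<otimes> d \<otimes> d)"
    using q(2) d unfolding C_commute [OF qq D_mult [OF *(3) *(3)], symmetric] by (simp add: m_assoc)
  also have "d \<otimes> d \<otimes> d \<otimes> d = d"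
    using D_cube [OF *(3)] d by simp
  finally have 1: "(q \<otimes> q) \<otimes> (q \<otimes> q) \<otimes> d = \<one>"
    using g(2) by simp
  consider "q \<otimes> q = \<one>" | "q \<otimes> q \<otimes> q = \<one>"
    using A4_element_order [OF *(1,2)] by (auto simp: q_def)
  then show ?thesis
  proof cases
    case 1
    then have "d = \<one>"
      using \<open>(q \<otimes> q) \<otimes> (q \<otimes> q) \<otimes> d = \<one>\<close> d by simp
    then show ?thesis
      using gg 1 by simp
  next
    case 2
    have "(q \<otimes> q) \<otimes> (q \<otimes> q) = q"
      using 2 q(2) by (simp add: m_assoc [symmetric])
    then have "q \<otimes> d = \<one>"
      using 1 by simp
    then have "g = \<zeta>"
      using g_eq \<zeta>(1) by simp
    then show ?thesis
      using \<zeta>(2) by simp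
  qed
qed

text \<open>
  Each \<open>v\<close> multiplies \<open>u\<close> by an element of \<open>B\<close> in \<open>K\<close>, that is by \<open>\<zeta>p\<close> with \<open>p\<close> in \<open>D\<close>. Since \<open>v\<close> is an
  involution and \<open>p\<close> has odd order, \<open>p\<close> is trivial, so \<open>V\<close> acts on \<open>u\<close> through a character with values in
  \<open>{1, z}\<close>. Conjugation by \<open>y\<close> changes \<open>u\<close> only by an element of \<open>D\<close>, which \<open>V\<close> centralizes; hence the
  character takes the same value on \<open>a\<close>, \<open>b\<close> and \<open>c = ab\<close> and is trivial.
\<close>

lemma V_centralizes_K_outside_C:
  assumes ex: "C \<noteq> carrier G" and u: "u \<in> K" "u \<notin> C" and v: "v \<in> V"
  shows "v \<rhd> u = u"
proof -
  have u_closed: "u \<in> carrier G"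
    using u by simp
  have twist: "\<exists>\<zeta>\<in>{\<one>, z}. v \<rhd> u = u \<otimes> \<zeta>" if v: "v \<in> V" for v
  proof -
    define h where "h = inv u \<otimes> (v \<rhd> u)"
    have hK: "h \<in> K" and hC: "h \<in> C"
      using u v by (simp_all add: h_def C_mult_iff)
    then have "h \<in> B"
      unfolding B_def by simp
    then obtain p \<zeta> where h: "p \<in> P" "\<zeta> \<in> {\<one>, z}" "h = \<zeta> \<otimes> p"
      by (rule B_cases)
    note \<zeta> = central_one_or_z [OF h(2)]
    have "inv \<zeta> \<otimes> h \<in> K"
      using hK \<zeta>(6) by simp
    moreover have "inv \<zeta> \<otimes> h = p"
      using h(1,3) \<zeta>(1) by simp
    ultimately have p: "p \<in> D"
      using h(1) P_inter_K by simp
    have vu: "v \<rhd> u = u \<otimes> (\<zeta> \<otimes> p)"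
      using u_closed v unfolding h(3) [symmetric] by (simp add: h_def)
    have "u = v \<rhd> v \<rhd> u"
      using V_conj_sq [OF v u_closed] by simp
    also have "\<dots> = v \<rhd> (u \<otimes> (\<zeta> \<otimes> p))"
      by (simp only: vu)
    also have "\<dots> = u \<otimes> (\<zeta> \<otimes> p) \<otimes> (\<zeta> \<otimes> p)"
      using u_closed v p \<zeta>(1,3) by (simp add: conj_mult vu)
    also have "\<dots> = u \<otimes> (\<zeta> \<otimes> (p \<otimes> \<zeta>) \<otimes> p)"
      using u_closed h(1) \<zeta>(1) by (simp add: m_assoc)
    also have "\<dots> = u \<otimes> (\<zeta> \<otimes> \<zeta> \<otimes> (p \<otimes> p))"
      unfolding \<zeta>(4) [OF P_closed [OF h(1)]] using h(1) \<zeta>(1) by (simp add: m_assoc)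
    also have "\<dots> = u \<otimes> (p \<otimes> p)"
      using h(1) by (simp add: \<zeta>(2))
    finally have "p \<otimes> p = \<one>"
      using u_closed h(1) by simp
    then have "p = \<one>"
      using h(1) P_no_involution by blast
    then show ?thesis
      using vu h(2) \<zeta>(1) by (intro bexI [of _ \<zeta>]) auto
  qed
  have "\<exists>d\<in>D. inv y \<rhd> u = u \<otimes> d"
  proof -
    have "u \<in> M" "u \<in> N"
      using u by simp_all
    then obtain d where d: "d \<in> D" "u \<rhd> y = y \<otimes> d"
      using mem_M_iff [of u] by auto
    have "inv y \<rhd> u = inv y \<otimes> (u \<rhd> y) \<otimes> u"
      using u_closed by (simp add: conj_by_def m_assoc)
    also have "\<dots> = d \<otimes> u"
      using d u_closed by (simp add: m_assoc)
    also have "\<dots> = u \<otimes> (inv u \<rhd> d)"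
      using d u_closed by (simp add: conj_by_def m_assoc)
    finally show ?thesis
      using d u_closed by (intro bexI [of _ "inv u \<rhd> d"]) auto
  qed
  then obtain d where d: "d \<in> D" "inv y \<rhd> u = u \<otimes> d"
    by blast
  have transport: "(y \<rhd> v) \<rhd> u = u \<otimes> \<zeta>" if v: "v \<in> V" and \<zeta>: "\<zeta> \<in> {\<one>, z}" "v \<rhd> u = u \<otimes> \<zeta>" for v \<zeta>
  proof -
    note \<zeta>' = central_one_or_z [OF \<zeta>(1)]
    have "(y \<rhd> v) \<rhd> u = y \<rhd> v \<rhd> (u \<otimes> d)"
      using v u_closed d by (simp add: conj_shift)
    also have "v \<rhd> (u \<otimes> d) = u \<otimes> (\<zeta> \<otimes> d)"
      using v u_closed d(1) \<zeta>'(1) by (simp add: conj_mult \<zeta>(2) m_assoc)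
    also have "\<dots> = u \<otimes> d \<otimes> \<zeta>"
      unfolding \<zeta>'(4) [OF P_closed [OF D_in_P [OF d(1)]], symmetric]
      using u_closed d(1) \<zeta>'(1) by (simp add: m_assoc)
    also have "y \<rhd> (u \<otimes> d \<otimes> \<zeta>) = (y \<rhd> inv y \<rhd> u) \<otimes> \<zeta>"
      using u_closed d(1) \<zeta>'(1,3) by (simp add: conj_mult [of y "u \<otimes> d"] d(2))
    finally show ?thesis
      using u_closed by simp
  qed
  obtain \<zeta> where \<zeta>: "\<zeta> \<in> {\<one>, z}" "a \<rhd> u = u \<otimes> \<zeta>"
    using twist mem_V by blast
  note \<zeta>' = central_one_or_z [OF \<zeta>(1)]
  have b: "b \<rhd> u = u \<otimes> \<zeta>"
    using transport [OF mem_V(1) \<zeta>] by (simp add: y_a)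
  have c: "c \<rhd> u = u \<otimes> \<zeta>"
    using transport [OF mem_V(2) \<zeta>(1) b] by (simp add: y_b)
  have "c \<rhd> u = a \<rhd> b \<rhd> u"
    using u_closed by (simp add: c_def conj_conj)
  also have "\<dots> = u \<otimes> \<zeta> \<otimes> \<zeta>"
    using u_closed \<zeta>'(1,3) by (simp add: b conj_mult \<zeta>(2))
  also have "\<dots> = u"
    using u_closed \<zeta>'(1) by (simp add: m_assoc \<zeta>'(2))
  finally have "\<zeta> = \<one>"
    using c u_closed \<zeta>'(1) by simp
  then show ?thesis
    using v \<zeta>(2) b c u_closed by (auto simp: V_def)
qed

text \<open>
  The square of \<open>q\<close> generates the same subgroup as \<open>q\<close>, because \<open>q\<close> has odd order.
\<close>

lemma P_square_in_D: "q \<in> P \<Longrightarrow> q \<otimes> q \<in> D \<Longrightarrow> q \<in> D"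
proof -
  assume q: "q \<in> P" "q \<otimes> q \<in> D"
  have "q \<otimes> ((q \<otimes> q) \<otimes> (q \<otimes> q) \<otimes> (q \<otimes> q) \<otimes> (q \<otimes> q)) = q [^] (9::nat)"
    using q(1) by (simp add: numeral_eq_Suc m_assoc)
  then have "q = inv ((q \<otimes> q) \<otimes> (q \<otimes> q) \<otimes> (q \<otimes> q) \<otimes> (q \<otimes> q))"
    using q(1) by (intro inv_equality [symmetric]) (auto simp: P_pow_9)
  then show "q \<in> D"
    using q(2) by (metis D_inv D_mult)
qed

lemma M_conj_quotient_in_D: "n \<in> M \<Longrightarrow> q \<in> P \<Longrightarrow> (n \<rhd> q) \<otimes> inv q \<in> D"
proof -
  assume n: "n \<in> M" and q: "q \<in> P"
  obtain e where e: "e \<in> D" "n \<rhd> y = y \<otimes> e"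
    using n mem_M_iff [of n] by auto
  have e': "n \<rhd> inv y = inv y \<otimes> inv e"
    using n e P_commute [of "inv e" "inv y"] by (simp add: conj_inv inv_mult_group)
  have n_closed: "n \<in> carrier G"
    using n by simp
  from q show ?thesis
  proof (cases rule: P_cases)
    case (1 d)
    then show ?thesis
      using n_closed by simp
  next
    case (2 d)
    have "(n \<rhd> q) \<otimes> inv q = y \<rhd> (e \<otimes> (n \<rhd> d) \<otimes> inv d)"
      using 2 e n_closed by (simp add: conj_mult e conj_by_def [of y] m_assoc inv_mult_group)
    then show ?thesis
      using 2 e n_closed by simp
  next
    case (3 d)
    have "(n \<rhd> q) \<otimes> inv q = inv y \<rhd> (inv e \<otimes> (n \<rhd> d) \<otimes> inv d)"
      using 3 e n_closed by (simp add: conj_mult e' conj_by_def [of "inv y"] m_assoc inv_mult_group)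
    then show ?thesis
      using 3 e n_closed by simp
  qed
qed

lemma not_M_conj_product_in_D: "n \<in> N \<Longrightarrow> n \<notin> M \<Longrightarrow> q \<in> P \<Longrightarrow> (n \<rhd> q) \<otimes> q \<in> D"
proof -
  assume n: "n \<in> N" "n \<notin> M" and q: "q \<in> P"
  obtain e where e: "e \<in> D" "n \<rhd> y = inv y \<otimes> e"
    using not_M_conj_y [OF n] by auto
  have e': "n \<rhd> inv y = y \<otimes> inv e"
    using n e P_commute [of "inv e" y] by (simp add: conj_inv inv_mult_group)
  have n_closed: "n \<in> carrier G"
    using n by simp
  from q show ?thesis
  proof (cases rule: P_cases)
    case (1 d)
    then show ?thesis
      using n_closed by simp
  next
    case (2 d)
    have "(n \<rhd> q) \<otimes> q = (inv y \<rhd> (e \<otimes> (n \<rhd> d))) \<otimes> d"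
      using 2 e n_closed by (simp add: conj_mult [of n] e conj_by_def [of "inv y"] m_assoc)
    then show ?thesis
      using 2 e n_closed by simp
  next
    case (3 d)
    have "(n \<rhd> q) \<otimes> q = (y \<rhd> (inv e \<otimes> (n \<rhd> d))) \<otimes> d"
      using 3 e n_closed by (simp add: conj_mult [of n] e' conj_by_def [of y] m_assoc)
    then show ?thesis
      using 3 e n_closed by simp
  qed
qed

text \<open>
  The element \<open>u\<close> of order 4 is not in \<open>C\<close>, so \<open>x\<close> lies outside \<open>D\<close> and \<open>u\<close> in \<open>N\<close>; as \<open>u\<close> fixes \<open>x\<close>, it acts
  trivially on the quotient of \<open>P\<close> by \<open>D\<close>. Consequently \<open>u\<close> lies in \<open>K\<close> and all of \<open>N\<close> acts trivially on
  that quotient, which forces \<open>r\<close> into \<open>D\<close>. Thus \<open>t = uh\<close> with \<open>h = qd\<zeta>\<close> in \<open>C\<close>, and since \<open>u\<close> commutes with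
  \<open>V\<close> and fixes \<open>y\<close> modulo \<open>D\<close>, the square of \<open>t\<close> is \<open>zq\<^sup>2e\<close> with \<open>e\<close> in \<open>D\<close>. It is trivial, so
  \<open>z = q\<^sup>2e\<close>. As \<open>q\<close> has order at most 3, this puts \<open>z\<close> into \<open>P\<close> or, after cubing, makes it trivial.
\<close>

lemma noncentral_D_contradiction:
  assumes ex: "C \<noteq> carrier G"
    and x: "x \<in> P" "x \<noteq> \<one>"
    and u: "u \<in> carrier G" "u [^] (2::nat) \<noteq> \<one>" "u [^] (4::nat) = \<one>" "u \<rhd> x = x"
    and r: "r \<in> P" "r \<noteq> \<one>" and t: "t \<in> carrier G" "t [^] (2::nat) = \<one>" "t \<rhd> r = inv r"
  shows False
proof -
  have uu: "u \<otimes> u \<noteq> \<one>"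
    using u by (simp add: numeral_2_eq_2)
  have tt: "t \<otimes> t = \<one>"
    using t by (simp add: numeral_2_eq_2)
  have uC: "u \<notin> C"
    using C_no_order_4 [OF ex _ u(3)] uu by blast
  have xD: "x \<notin> D"
    using C_iff [of u x] x u uC by blast
  have uN: "u \<in> N"
    using fusion_outside_D [OF x(1) xD u(1)] u(4) x by simp
  have uM: "u \<in> M"
    using not_M_conj_product_in_D [OF uN _ x(1)] u(4) P_square_in_D [OF x(1)] xD by auto
  have uK: "u \<in> K"
    using uM u(3) by (rule mem_K_if_pow_4)
  have uB: "u \<notin> B"
    using uC by auto
  have "inv u \<notin> B"
    using uB u by (metis B_inv inv_inv)
  then have "u \<otimes> u \<in> B"
    using N_outside_B [of "inv u" u] uN uB u(1) by simp
  moreover have "u \<otimes> u \<otimes> (u \<otimes> u) = \<one>"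
    using u by (simp add: numeral_eq_Suc m_assoc)
  ultimately have uz: "u \<otimes> u = z"
    using B_involution uu by blast
  have rD: "r \<in> D"
  proof (rule ccontr)
    assume rD: "r \<notin> D"
    have tN: "t \<in> N"
      using fusion_outside_D [OF r(1) rD t(1)] t(3) r by simp
    have "t \<notin> M"
    proof
      assume "t \<in> M"
      then have "inv r \<otimes> inv r \<in> D"
        using M_conj_quotient_in_D [OF _ r(1)] t(3) by metis
      then have "inv r \<in> D"
        using P_square_in_D [OF P_inv [OF r(1)]] by blast
      then show False
        using rD r(1) by (metis D_inv P_closed inv_inv)
    qed
    then have "t \<notin> B" by auto
    then have "inv u \<otimes> t \<in> M"
      using N_outside_B [OF uN uB tN] by simp
    then show False
      using \<open>t \<notin> M\<close> uM uN tN by (simp add: M_mult_iff)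
  qed
  have tC: "t \<notin> C"
  proof
    assume "t \<in> C"
    then have "inv r = r"
      using C_conj_D [of t r] rD t(3) by simp
    then show False
      using P_eq_inv [of r] r by simp
  qed
  define h where "h = inv u \<otimes> t"
  have hC: "h \<in> C"
    using u t uC tC by (simp add: h_def C_mult_iff)
  obtain v w d \<zeta> where *: "v \<in> V" "w \<in> {\<one>, y, inv y}" "d \<in> D" "\<zeta> \<in> {\<one>, z}" "h = v \<otimes> w \<otimes> d \<otimes> \<zeta>"
    using ex hC by (rule C_normal_form)
  note \<zeta> = central_one_or_z [OF *(4)]
  have w: "w \<in> P"
    using *(2) by auto
  define q where "q = v \<otimes> w"
  have q: "q \<in> C" "q \<in> carrier G"
    using *(1) w by (simp_all add: q_def C_mult_iff)
  have d: "d \<in> carrier G"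
    using *(3) by simp
  have h_eq: "h = \<zeta> \<otimes> (q \<otimes> d)"
    using *(5) \<zeta>(4) [of "q \<otimes> d"] q d by (simp add: q_def)
  have "inv u \<rhd> v = v"
    using V_centralizes_K_outside_C [OF ex uK uC *(1)] u(1) *(1) conj_fixed_sym conj_inv_fixed by auto
  moreover have "\<exists>e\<in>D. inv u \<rhd> w = w \<otimes> e"
  proof (rule bexI)
    show e: "(inv u \<rhd> w) \<otimes> inv w \<in> D"
      using M_conj_quotient_in_D [of "inv u" w] uM uN w by simp
    have "inv u \<rhd> w = ((inv u \<rhd> w) \<otimes> inv w) \<otimes> w"
      using u(1) w by (simp add: m_assoc)
    also have "\<dots> = w \<otimes> ((inv u \<rhd> w) \<otimes> inv w)"
      using e w by (intro P_commute) auto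
    finally show "inv u \<rhd> w = w \<otimes> ((inv u \<rhd> w) \<otimes> inv w)" .
  qed
  ultimately obtain e where e: "e \<in> D" "inv u \<rhd> q = q \<otimes> e"
    using u(1) *(1) w by (auto simp: q_def conj_mult m_assoc)
  define f where "f = e \<otimes> inv d"
  have f: "f \<in> D" "f \<in> carrier G"
    using e * by (simp_all add: f_def)
  have iu_h: "inv u \<rhd> h = \<zeta> \<otimes> (q \<otimes> f)"
    using u(1) uC q d \<zeta>(1,3) *(3) e by (simp add: h_eq conj_mult not_C_conj_D f_def m_assoc)
  have "t = u \<otimes> h"
    using u t by (simp add: h_def)
  then have "t \<otimes> t = u \<otimes> u \<otimes> ((inv u \<rhd> h) \<otimes> h)"
    using u(1) hC by (simp add: conj_by_def m_assoc)
  also have "(inv u \<rhd> h) \<otimes> h = \<zeta> \<otimes> ((q \<otimes> f) \<otimes> \<zeta>) \<otimes> (q \<otimes> d)"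
    unfolding iu_h unfolding h_eq using \<zeta>(1) q(2) f(2) d by (simp add: m_assoc)
  also have "\<dots> = \<zeta> \<otimes> \<zeta> \<otimes> (q \<otimes> (f \<otimes> q) \<otimes> d)"
    using \<zeta>(1) q(2) f(2) d by (subst \<zeta>(4)) (simp_all add: m_assoc)
  also have "\<dots> = q \<otimes> (f \<otimes> q) \<otimes> d"
    using q(2) f(2) d by (simp add: \<zeta>(2))
  also have "\<dots> = q \<otimes> q \<otimes> (f \<otimes> d)"
    unfolding C_commute [OF q(1) f(1), symmetric] using q(2) f(2) d by (simp add: m_assoc)
  also have "f \<otimes> d = e"
    using e(1) d by (simp add: f_def m_assoc)
  finally have "z \<otimes> (q \<otimes> q \<otimes> e) = \<one>"
    using tt uz by simp
  then have qe: "q \<otimes> q \<otimes> e = z"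
    using q(2) e(1) by (metis D_in_P P_closed inv_closed inv_equality inv_inv inv_z m_closed z_closed)
  have e_closed: "e \<in> carrier G"
    using e(1) by simp
  have qq: "q \<otimes> q = z \<otimes> inv e"
    using qe q(2) e_closed by (metis inv_solve_right m_closed z_closed)
  consider "q \<otimes> q = \<one>" | "q \<otimes> q \<otimes> q = \<one>"
    using A4_element_order [OF *(1,2)] by (auto simp: q_def)
  then show False
  proof cases
    case 1
    then have "e = z"
      using qe e_closed by simp
    then show False
      using z_facts(2) D_in_P [OF e(1)] by simp
  next
    case 2
    have "(q \<otimes> q) \<otimes> (q \<otimes> q) \<otimes> (q \<otimes> q) = (q \<otimes> q \<otimes> q) \<otimes> (q \<otimes> q \<otimes> q)"
      using q(2) by (simp add: m_assoc)
    then have "(z \<otimes> inv e) \<otimes> (z \<otimes> inv e) \<otimes> (z \<otimes> inv e) = \<one>"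
      unfolding 2 by (simp add: qq)
    moreover have "(z \<otimes> inv e) \<otimes> (z \<otimes> inv e) \<otimes> (z \<otimes> inv e) = z"
    proof -
      define i where "i = inv e"
      have i: "i \<in> P" "i \<in> carrier G" "i \<otimes> i \<otimes> i = \<one>"
        using e(1) D_cube [of i] by (simp_all add: i_def)
      have "(z \<otimes> i) \<otimes> (z \<otimes> i) = z \<otimes> (i \<otimes> z) \<otimes> i"
        using i(2) by (simp add: m_assoc)
      also have "\<dots> = z \<otimes> z \<otimes> (i \<otimes> i)"
        unfolding z_commutes_P [OF i(1), symmetric] using i(2) by (simp add: m_assoc)
      finally have "(z \<otimes> i) \<otimes> (z \<otimes> i) = i \<otimes> i"
        using i(2) by (simp add: z_facts(3))
      moreover have "(i \<otimes> i) \<otimes> (z \<otimes> i) = (i \<otimes> i) \<otimes> (i \<otimes> z)"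
        by (simp only: z_commutes_P [OF i(1)])
      moreover have "\<dots> = z"
        using i(2) by (simp add: m_assoc [symmetric] i(3))
      ultimately show ?thesis
        by (simp add: i_def)
    qed
    ultimately show False
      using z_facts(2) by auto
  qed
qed

end

section \<open>The isomorphism\<close>

theorem (in group) iso_S3_times_S4:
  assumes order: "order G = 144" and all: "all_groups_of_order_embed_in 12 G"
  shows "G \<cong> sym_group 3 \<times>\<times> sym_group 4"
proof -
  have fin: "finite (carrier G)"
    using order by (metis card.infinite order_def zero_neq_numeral)
  have prime_3: "Factorial_Ring.prime (3::nat)"
    by simp
  obtain P where P: "subgroup P G" "card P = 9"
    using sylow_thm [of 3 G 2 16] order fin is_group by auto
  have "card (lcosets P) * 9 = 144"
    using l_lagrange [OF fin P(1)] P(2) order by simp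
  then have ndvd: "\<not> 3 dvd card (lcosets P)"
    by presburger
  have into_P: "\<exists>g\<in>carrier G. g \<rhd> x \<in> P" if "x \<in> carrier G" "x [^] (3::nat) = \<one>" for x
    using p_element_conj_into_sylow [OF fin P(1) prime_3 ndvd that(1), of 1] that(2) by auto
  have commute: "p \<otimes> q = q \<otimes> p" if "p \<in> P" "q \<in> P" for p q
    using prime_square_subgroup_commute [OF P(1) prime_3 _ that] P(2) by simp
  obtain r t where rt: "r \<in> P" "r \<noteq> \<one>" "t \<in> carrier G" "t [^] (2::nat) = \<one>" "t \<rhd> r = inv r"
  proof -
    obtain s t where st: "s \<in> carrier G" "s \<noteq> \<one>" "s [^] (3::nat) = \<one>"
      "t \<in> carrier G" "t [^] (2::nat) = \<one>" "t \<rhd> s = inv s"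
      using all by (rule D6_elements)
    then obtain g where g: "g \<in> carrier G" "g \<rhd> s \<in> P"
      using into_P by blast
    show thesis
      by (rule that [of "g \<rhd> s" "g \<rhd> t"])
        (use st g in \<open>auto simp: conj_pow [symmetric] conj_conj_distrib conj_inv\<close>)
  qed
  obtain n where n: "n \<in> normalizer G P" "n \<rhd> r = t \<rhd> r"
    using burnside_fusion [OF fin P(1) prime_3, of 2 t r] P(2) ndvd commute rt
      subgroup.m_inv_closed [OF P(1) rt(1)] by auto
  obtain a y where ay: "a \<in> carrier G" "a \<noteq> \<one>" "a \<otimes> a = \<one>" "y \<in> P"
    "y [^] (3::nat) = \<one>" "y \<rhd> y \<rhd> a = a \<otimes> (y \<rhd> a)"
  proof -
    obtain a y where ay: "a \<in> carrier G" "y \<in> carrier G" "a \<noteq> \<one>" "a \<otimes> a = \<one>"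
      "y [^] (3::nat) = \<one>" "y \<rhd> y \<rhd> a = a \<otimes> (y \<rhd> a)"
      using all by (rule A4_elements)
    then obtain g where g: "g \<in> carrier G" "g \<rhd> y \<in> P"
      using into_P by blast
    show thesis
      by (rule that [of "g \<rhd> a" "g \<rhd> y"])
        (use ay g in \<open>auto simp: conj_pow [symmetric] conj_conj_distrib conj_mult [symmetric]\<close>)
  qed
  interpret A4: order_144_with_A4 G a y P
    by (intro order_144_with_A4.intro order_144_with_A4_axioms.intro group_axioms)
      (use order ay P n rt in auto)
  show ?thesis
  proof (cases "A4.B \<subseteq> P")
    case True
    then show ?thesis
      by (rule A4.iso_if_self_centralizing)
  next
    case False
    then interpret inv: order_144_with_A4_and_involution G a y P
      by unfold_locales
    show ?thesis
    proof (cases "A4.C = carrier G")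
      case True
      obtain s w where sw: "s \<in> carrier G" "s \<noteq> \<one>" "s [^] (3::nat) = \<one>"
        "w \<in> carrier G" "w [^] (2::nat) \<noteq> \<one>" "w [^] (4::nat) = \<one>" "w \<rhd> s = inv s"
        using all by (rule Dic3_elements)
      then obtain g where g: "g \<in> carrier G" "g \<rhd> s \<in> P"
        using into_P by blast
      have False
        by (rule inv.central_D_contradiction [OF True, of "g \<rhd> s" "g \<rhd> w" r t])
          (use sw g rt in \<open>auto simp: conj_pow [symmetric] conj_conj_distrib conj_inv\<close>)
      then show ?thesis ..
    next
      case False
      obtain x u where xu: "x \<in> carrier G" "x \<noteq> \<one>" "x [^] (3::nat) = \<one>"
        "u \<in> carrier G" "u [^] (2::nat) \<noteq> \<one>" "u [^] (4::nat) = \<one>" "u \<rhd> x = x"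
        using all by (rule Z12_elements)
      then obtain g where g: "g \<in> carrier G" "g \<rhd> x \<in> P"
        using into_P by blast
      have False
        by (rule inv.noncentral_D_contradiction [OF False, of "g \<rhd> x" "g \<rhd> u" r t])
          (use xu g rt in \<open>auto simp: conj_pow [symmetric] conj_conj_distrib conj_inv\<close>)
      then show ?thesis ..
    qed
  qed
qed

theorem theorem2:
  fixes G :: "('a, 'b) monoid_scheme"
  assumes "group G" and "order G = 144"
    and "all_groups_of_order_embed_in 12 G"
  shows "G \<cong> sym_group 3 \<times>\<times> sym_group 4"
  using assms by (rule group.iso_S3_times_S4)

end
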